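(* For Lebesgue-almost every $x\in(0,1)$, the sequence $(q_n(x))_{n\in\mathbb N}$ is a Benford sequence. Equivalently, for Lebesgue-almost every $x\in(0,1)$, the sequence $(\log_{10} q_n(x))_{n\in\mathbb N}$ is uniformly distributed mod $1$.
   Context: For irrational $x\in(0,1)$ write its continued fraction expansion $x=[a_1,a_2,\ldots]=1/(a_1+1/(a_2+\cdots))$ with $a_i\in\mathbb N$, and let $p_n/q_n=[a_1,\ldots,a_n]$ (in lowest terms, $q_n\geq 1$) be its $n$-th convergent; $q_n(x)$ denotes this denominator. A sequence $(x_n)$ of real numbers is uniformly distributed (u.d.) mod $1$ if for every $t\in[0,1)$, $\lim_{N\to\infty}\frac1N\#\{1\le n\le N:\{x_n\}\le t\}=t$, where $\{\cdot\}$ denotes the fractional part. For nonzero real $y$, its decimal significand $s(y)$ is the unique $t\in[1,10)$ with $|y|=10^k t$ for some $k\in\mathbb Z$. A sequence $(x_n)$ of nonzero reals is a Benford sequence if $\lim_{N\to\infty}\frac1N\#\{1\le n\le N: s(x_n)\le t\}=\log_{10}(t)$ for all $t\in[1,10)$. *)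

theory Defs
  imports "HOL-Analysis.Analysis"
begin

definition gauss_map :: "real \<Rightarrow> real" where
  "gauss_map x = 1 / x - of_int \<lfloor>1 / x\<rfloor>"

definition cf_digit :: "nat \<Rightarrow> real \<Rightarrow> nat" where
  "cf_digit n x = nat \<lfloor>1 / (gauss_map ^^ (n - 1)) x\<rfloor>"

fun cf_value :: "nat list \<Rightarrow> rat" where
  "cf_value [] = 0"
| "cf_value (a # as) = 1 / (of_nat a + cf_value as)"

definition cf_denom :: "nat \<Rightarrow> real \<Rightarrow> int" where
  "cf_denom n x = snd (quotient_of (cf_value (map (\<lambda>i. cf_digit i x) [1..<n+1])))"

definition significand :: "real \<Rightarrow> real" where
  "significand y = (THE t. 1 \<le> t \<and> t < 10 \<and> (\<exists>k::int. \<bar>y\<bar> = 10 powr (real_of_int k) * t))"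

definition benford :: "(nat \<Rightarrow> real) \<Rightarrow> bool" where
  "benford x \<longleftrightarrow> (\<forall>n\<ge>1. x n \<noteq> 0) \<and>
     (\<forall>t. 1 \<le> t \<and> t < 10 \<longrightarrow>
        (\<lambda>N. real (card {n \<in> {1..N}. significand (x n) \<le> t}) / real N) \<longlonglongrightarrow> log 10 t)"

end

theory Submission
  imports Defs "HOL-Library.Discrete_Functions"
begin

text \<open>
  Write \<open>r = q\<^sub>n\<^sub>-\<^sub>1 / q\<^sub>n\<close>. On a cylinder of rank \<open>n\<close> the image of Lebesgue measure under the
  \<open>n\<close>-th iterate of the Gauss map has density \<open>(1 + r) / (1 + r t)\<^sup>2\<close>, so under Lebesgue measure
  the ratios \<open>r\<close> form a Markov chain that moves from \<open>r\<close> to \<open>1 / (k + r)\<close> with probability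
  \<open>(1 + r) / ((k + r) (k + 1 + r))\<close>, and \<open>q\<^sub>n\<close> is the product of the factors \<open>k + r\<close>.
  For real \<open>\<alpha> \<noteq> 0\<close> the correlations of \<open>q\<^sub>m powr (\<i> \<alpha>)\<close> and \<open>q\<^sub>n powr (\<i> \<alpha>)\<close> are therefore
  governed by the transition operator twisted by \<open>(k + r) powr (\<i> \<alpha>)\<close>. On Lipschitz functions this
  operator is a strict contraction: branches with large \<open>k\<close> all land near \<open>0\<close>, where the function
  is nearly constant, and among them there are two whose phases \<open>\<alpha> ln (k + r)\<close> are nearly opposite
  for all \<open>r\<close>, so that they cancel. The correlations thus decay exponentially in \<open>\<bar>n - m\<bar>\<close>, the
  exponential sums have mean square \<open>O(N)\<close>, and Weyl's criterion applies almost everywhere.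
\<close>

section \<open>Almost sure convergence of averages from summable correlations\<close>

definition cesaro_mean :: "(nat \<Rightarrow> 'a::real_vector) \<Rightarrow> nat \<Rightarrow> 'a" where
  "cesaro_mean f N = (\<Sum>n=1..N. f n) /\<^sub>R real N"

lemma norm_cesaro_mean_le:
  fixes f :: "nat \<Rightarrow> 'a::real_normed_vector"
  assumes "\<And>n. norm (f n) \<le> B"
  shows "norm (cesaro_mean f N) \<le> B"
proof (cases "N = 0")
  case False
  then show ?thesis
    using sum_norm_bound[of "{1..N}" f B] assms
    by (simp add: cesaro_mean_def field_simps)
qed (simp add: cesaro_mean_def order.trans[OF norm_ge_zero assms])

lemma cesaro_mean_add: "cesaro_mean (\<lambda>n. f n + g n) N = cesaro_mean f N + cesaro_mean g N"
  by (simp add: cesaro_mean_def sum.distrib scaleR_right_distrib)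

lemma cesaro_mean_linear: "linear h \<Longrightarrow> cesaro_mean (\<lambda>n. h (f n)) N = h (cesaro_mean f N)"
  by (simp add: cesaro_mean_def linear_sum linear_cmul)

lemma norm_cesaro_mean_le_floor_sqrt:
  fixes z :: "nat \<Rightarrow> 'a::real_normed_vector"
  assumes z: "\<And>n. norm (z n) \<le> B" and N: "0 < N"
  defines "j \<equiv> floor_sqrt N"
  shows "norm (cesaro_mean z N) \<le> norm (cesaro_mean z (j\<^sup>2)) + 2 * B / real j"
proof -
  have B: "0 \<le> B" using norm_ge_zero z by (rule order.trans)
  have j: "0 < j" "j\<^sup>2 \<le> N" using N by (simp_all add: j_def)
  have "N < (Suc j)\<^sup>2" unfolding j_def by (rule Suc_floor_sqrt_power2_gt)
  then have gap: "N - j\<^sup>2 \<le> 2 * j" by (simp add: power2_eq_square)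
  have "norm (\<Sum>n\<in>{j\<^sup>2<..N}. z n) \<le> real (N - j\<^sup>2) * B"
    using sum_norm_bound[of "{j\<^sup>2<..N}" z B] z by simp
  also have "\<dots> \<le> real (2 * j) * B"
    using gap B by (intro mult_right_mono) (simp_all only: of_nat_le_iff)
  finally have rest: "norm (\<Sum>n\<in>{j\<^sup>2<..N}. z n) \<le> 2 * B * j" by (simp add: mult_ac)
  have "{1..N} = {1..j\<^sup>2} \<union> {j\<^sup>2<..N}" using j by auto
  then have "(\<Sum>n=1..N. z n) = (\<Sum>n=1..j\<^sup>2. z n) + (\<Sum>n\<in>{j\<^sup>2<..N}. z n)"
    by (simp only:) (rule sum.union_disjoint, auto)
  then have "norm (\<Sum>n=1..N. z n) \<le> norm (\<Sum>n=1..j\<^sup>2. z n) + 2 * B * j"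
    using rest by (auto intro: norm_triangle_mono)
  then have "norm (cesaro_mean z N) \<le> (norm (\<Sum>n=1..j\<^sup>2. z n) + 2 * B * j) / N"
    by (simp add: cesaro_mean_def divide_inverse_commute mult_left_mono)
  also have "\<dots> \<le> (norm (\<Sum>n=1..j\<^sup>2. z n) + 2 * B * j) / real (j\<^sup>2)"
    using B j N by (intro divide_left_mono mult_pos_pos) (simp_all flip: of_nat_power)
  also have "\<dots> = norm (cesaro_mean z (j\<^sup>2)) + 2 * B / j"
    using j by (simp add: cesaro_mean_def power2_eq_square field_simps)
  finally show ?thesis .
qed

lemma cesaro_mean_tendsto_0_of_squares:
  fixes z :: "nat \<Rightarrow> 'a::real_normed_vector"
  assumes z: "\<And>n. norm (z n) \<le> B"
    and squares: "(\<lambda>j. cesaro_mean z (j\<^sup>2)) \<longlonglongrightarrow> 0"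
  shows "cesaro_mean z \<longlonglongrightarrow> 0"
proof -
  define b where "b j = norm (cesaro_mean z (j\<^sup>2)) + 2 * B / real j" for j
  have "b \<longlonglongrightarrow> 0 + 0"
    unfolding b_def by (intro tendsto_add tendsto_norm_zero squares lim_const_over_n)
  moreover have "filterlim floor_sqrt at_top sequentially"
    unfolding filterlim_at_top
    by (intro allI eventually_sequentiallyI[of "_ ^ 2"]) (simp add: le_floor_sqrt_iff)
  ultimately have "(\<lambda>N. b (floor_sqrt N)) \<longlonglongrightarrow> 0"
    using filterlim_compose by force
  then show ?thesis
  proof (rule Lim_null_comparison[rotated])
    show "\<forall>\<^sub>F N in sequentially. norm (cesaro_mean z N) \<le> b (floor_sqrt N)"
      using eventually_gt_at_top[of 0]
      by eventually_elim (simp add: b_def norm_cesaro_mean_le_floor_sqrt[OF z])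
  qed
qed

lemma AE_tendsto_0_of_summable_integral:
  fixes f :: "nat \<Rightarrow> 'a \<Rightarrow> real"
  assumes int: "\<And>j. integrable M (f j)" and nonneg: "\<And>j x. 0 \<le> f j x"
    and summable: "summable (\<lambda>j. \<integral>x. f j x \<partial>M)"
  shows "AE x in M. (\<lambda>j. f j x) \<longlonglongrightarrow> 0"
proof -
  have [measurable]: "f j \<in> borel_measurable M" for j using int by blast
  have "(\<integral>\<^sup>+x. (\<Sum>j. ennreal (f j x)) \<partial>M) = (\<Sum>j. \<integral>\<^sup>+x. ennreal (f j x) \<partial>M)"
    by (intro nn_integral_suminf) measurable
  also have "\<dots> = (\<Sum>j. ennreal (\<integral>x. f j x \<partial>M))"
    by (intro suminf_cong nn_integral_eq_integral int) (simp add: nonneg)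
  also have "\<dots> \<noteq> \<infinity>"
    unfolding infinity_ennreal_def
    by (rule ennreal_suminf_neq_top[OF summable]) (simp add: nonneg)
  finally have "(\<integral>\<^sup>+x. (\<Sum>j. ennreal (f j x)) \<partial>M) \<noteq> \<infinity>" .
  then have "AE x in M. (\<Sum>j. ennreal (f j x)) \<noteq> \<infinity>"
    by (intro nn_integral_PInf_AE) measurable
  then show ?thesis
  proof eventually_elim
    case (elim x)
    then have "summable (\<lambda>j. f j x)" using summable_suminf_not_top[of "\<lambda>j. f j x"] nonneg by auto
    then show ?case by (rule summable_LIMSEQ_zero)
  qed
qed

lemma (in finite_measure) AE_cesaro_mean_tendsto_0_of_L2:
  fixes z :: "nat \<Rightarrow> 'a \<Rightarrow> 'b::{real_normed_vector, second_countable_topology}"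
  assumes [measurable]: "\<And>n. z n \<in> borel_measurable M"
    and bound: "\<And>n x. norm (z n x) \<le> B"
    and L2: "\<And>N. (\<integral>x. (norm (\<Sum>n=1..N. z n x))\<^sup>2 \<partial>M) \<le> C * real N"
  shows "AE x in M. cesaro_mean (\<lambda>n. z n x) \<longlonglongrightarrow> 0"
proof -
  define f where "f j x = (norm (cesaro_mean (\<lambda>n. z n x) (j\<^sup>2)))\<^sup>2" for j x
  have int: "integrable M (f j)" for j
  proof (rule integrable_const_bound[where B = "B\<^sup>2"])
    show "AE x in M. norm (f j x) \<le> B\<^sup>2"
      by (auto simp: f_def intro!: power_mono norm_cesaro_mean_le bound)
    show "f j \<in> borel_measurable M" unfolding f_def cesaro_mean_def by measurable
  qed
  have "(\<integral>x. f j x \<partial>M) \<le> C * inverse (real j ^ 2)" for j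
  proof -
    have "(\<integral>x. f j x \<partial>M) = (\<integral>x. (norm (\<Sum>n=1..j\<^sup>2. z n x))\<^sup>2 \<partial>M) / (real (j\<^sup>2))\<^sup>2"
      by (simp add: f_def cesaro_mean_def power_mult_distrib divide_inverse_commute power_inverse)
    also have "\<dots> \<le> C * real (j\<^sup>2) / (real (j\<^sup>2))\<^sup>2"
      by (intro divide_right_mono L2) simp
    also have "\<dots> = C * inverse (real j ^ 2)" by (simp add: power2_eq_square divide_simps)
    finally show ?thesis .
  qed
  moreover have "0 \<le> (\<integral>x. f j x \<partial>M)" for j by (simp add: f_def)
  ultimately have "summable (\<lambda>j. \<integral>x. f j x \<partial>M)"
    by (intro summable_comparison_test'[OF summable_mult[OF inverse_power_summable[of 2]], of 0])
      auto
  then have "AE x in M. (\<lambda>j. f j x) \<longlonglongrightarrow> 0"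
    by (intro AE_tendsto_0_of_summable_integral int) (simp_all add: f_def)
  then show ?thesis
  proof eventually_elim
    case (elim x)
    from tendsto_real_sqrt[OF this] have "(\<lambda>j. cesaro_mean (\<lambda>n. z n x) (j\<^sup>2)) \<longlonglongrightarrow> 0"
      by (simp add: f_def tendsto_norm_zero_iff)
    then show ?case using bound by (rule cesaro_mean_tendsto_0_of_squares[rotated])
  qed
qed

lemma sum_lag_le:
  fixes c :: "nat \<Rightarrow> real"
  assumes c: "summable c" "\<And>n. 0 \<le> c n"
  shows "(\<Sum>n=1..N. c (max m n - min m n)) \<le> 2 * suminf c"
proof -
  have part: "(\<Sum>n\<in>A. c (d n)) \<le> suminf c" if "finite A" "inj_on d A" for A :: "nat set" and d
    using sum_le_suminf[of c "d ` A"] c that by (simp add: sum.reindex)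
  have "(\<Sum>n=1..N. c (max m n - min m n))
      = (\<Sum>n\<in>{1..N} \<inter> {..m}. c (m - n)) + (\<Sum>n\<in>{1..N} - {..m}. c (n - m))"
    by (subst sum.Int_Diff[of _ _ "{..m}"]) (auto simp: max_def min_def intro!: sum.cong)
  also have "\<dots> \<le> suminf c + suminf c"
    by (intro add_mono part) (auto simp: inj_on_def)
  finally show ?thesis by simp
qed

lemma (in finite_measure) L2_sum_le_of_correlations:
  fixes z :: "nat \<Rightarrow> 'a \<Rightarrow> 'b::{real_inner, second_countable_topology}"
  assumes [measurable]: "\<And>n. z n \<in> borel_measurable M"
    and bound: "\<And>n x. norm (z n x) \<le> B"
    and corr: "\<And>m n. (\<integral>x. z m x \<bullet> z (m + n) x \<partial>M) \<le> c n"
    and c: "summable c" "\<And>n. 0 \<le> c n"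
  shows "(\<integral>x. (norm (\<Sum>n=1..N. z n x))\<^sup>2 \<partial>M) \<le> 2 * suminf c * real N"
proof -
  have int: "integrable M (\<lambda>x. z m x \<bullet> z n x)" for m n
  proof (rule integrable_const_bound[where B = "B * B"])
    have "norm (z m x \<bullet> z n x) \<le> B * B" for x
      using Cauchy_Schwarz_ineq2[of "z m x" "z n x"] bound[of m x] bound[of n x]
      by (smt (verit) mult_mono norm_ge_zero real_norm_def)
    then show "AE x in M. norm (z m x \<bullet> z n x) \<le> B * B" by simp
  qed measurable
  have corr': "(\<integral>x. z m x \<bullet> z n x \<partial>M) \<le> c (max m n - min m n)" for m n
    using corr[of m "n - m"] corr[of n "m - n"]
    by (cases "m \<le> n") (auto simp: max_def min_def inner_commute)
  have "(\<integral>x. (norm (\<Sum>n=1..N. z n x))\<^sup>2 \<partial>M) = (\<Sum>m=1..N. \<Sum>n=1..N. \<integral>x. z m x \<bullet> z n x \<partial>M)"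
    using int by (simp add: power2_norm_eq_inner inner_sum_left inner_sum_right) (rule sum.swap)
  also have "\<dots> \<le> (\<Sum>m=1..N. \<Sum>n=1..N. c (max m n - min m n))"
    by (intro sum_mono corr')
  also have "\<dots> \<le> (\<Sum>m=1..N. 2 * suminf c)"
    by (intro sum_mono sum_lag_le c)
  finally show ?thesis by (simp add: mult_ac)
qed

theorem (in finite_measure) AE_cesaro_mean_tendsto_0_of_correlations:
  fixes z :: "nat \<Rightarrow> 'a \<Rightarrow> 'b::{real_inner, second_countable_topology}"
  assumes "\<And>n. z n \<in> borel_measurable M" "\<And>n x. norm (z n x) \<le> B"
    and "\<And>m n. (\<integral>x. z m x \<bullet> z (m + n) x \<partial>M) \<le> c n"
    and "summable c" "\<And>n. 0 \<le> c n"
  shows "AE x in M. cesaro_mean (\<lambda>n. z n x) \<longlonglongrightarrow> 0"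
  by (intro AE_cesaro_mean_tendsto_0_of_L2[OF assms(1,2) L2_sum_le_of_correlations[OF assms]])

section \<open>Weyl's criterion\<close>

definition frequency :: "(nat \<Rightarrow> bool) \<Rightarrow> nat \<Rightarrow> real" where
  "frequency P N = real (card {n \<in> {1..N}. P n}) / real N"

definition uniformly_distributed_mod1 :: "(nat \<Rightarrow> real) \<Rightarrow> bool" where
  "uniformly_distributed_mod1 x \<longleftrightarrow>
     (\<forall>t. 0 \<le> t \<and> t < 1 \<longrightarrow> frequency (\<lambda>n. frac (x n) \<le> t) \<longlonglongrightarrow> t)"

lemma frequency_eq_cesaro_mean: "frequency P N = cesaro_mean (\<lambda>n. of_bool (P n)) N"
  by (simp add: frequency_def cesaro_mean_def of_bool_def sum.If_cases Int_def
      divide_inverse_commute)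

lemma frequency_mono: "(\<And>n. P n \<Longrightarrow> Q n) \<Longrightarrow> frequency P N \<le> frequency Q N"
  unfolding frequency_def by (intro divide_right_mono of_nat_mono card_mono) auto

lemma frequency_not:
  assumes "0 < N"
  shows "frequency (\<lambda>n. \<not> P n) N = 1 - frequency P N"
proof -
  have "card {1..N} = card ({1..N} \<inter> {n. P n}) + card ({1..N} - {n. P n})"
    by (rule card_Int_Diff) simp
  also have "{1..N} \<inter> {n. P n} = {n \<in> {1..N}. P n}" by auto
  also have "{1..N} - {n. P n} = {n \<in> {1..N}. \<not> P n}" by auto
  finally have "real N = real (card {n \<in> {1..N}. P n}) + real (card {n \<in> {1..N}. \<not> P n})"
    by simp
  with assms show ?thesis by (simp add: frequency_def field_simps)
qed

definition averages_to_integral :: "(nat \<Rightarrow> real) \<Rightarrow> (real \<Rightarrow> 'a::banach) \<Rightarrow> bool" where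
  "averages_to_integral x f \<longleftrightarrow> f integrable_on {0..1} \<and>
     cesaro_mean (\<lambda>n. f (x n)) \<longlonglongrightarrow> integral {0..1} f"

lemma averages_to_integral_add:
  assumes "averages_to_integral x f" "averages_to_integral x g"
  shows "averages_to_integral x (\<lambda>u. f u + g u)"
  using assms
  by (auto simp: averages_to_integral_def cesaro_mean_add[abs_def]
      Henstock_Kurzweil_Integration.integral_add
      intro: Henstock_Kurzweil_Integration.integrable_add tendsto_add)

lemma averages_to_integral_bounded_linear:
  assumes "averages_to_integral x f" and h: "bounded_linear h"
  shows "averages_to_integral x (\<lambda>u. h (f u))"
  unfolding averages_to_integral_def
proof
  have int: "f integrable_on {0..1}" and lim: "cesaro_mean (\<lambda>n. f (x n)) \<longlonglongrightarrow> integral {0..1} f"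
    using assms(1) by (simp_all add: averages_to_integral_def)
  show "(\<lambda>u. h (f u)) integrable_on {0..1}"
    using integrable_linear[OF int h] by (simp add: o_def)
  have "cesaro_mean (\<lambda>n. h (f (x n))) = (\<lambda>N. h (cesaro_mean (\<lambda>n. f (x n)) N))"
    by (intro ext cesaro_mean_linear bounded_linear.linear h)
  moreover have "integral {0..1} (\<lambda>u. h (f u)) = h (integral {0..1} f)"
    using integral_linear[OF int h] by (simp add: o_def)
  ultimately show "cesaro_mean (\<lambda>n. h (f (x n))) \<longlonglongrightarrow> integral {0..1} (\<lambda>u. h (f u))"
    using bounded_linear.tendsto[OF h lim] by simp
qed

lemma averages_to_integral_close:
  assumes f: "f integrable_on {0..1}" and g: "averages_to_integral x g"
    and close: "\<And>u. norm (f u - g u) \<le> e"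
  shows "norm (integral {0..1} g - integral {0..1} f) \<le> e"
    and "norm (cesaro_mean (\<lambda>n. f (x n)) N - cesaro_mean (\<lambda>n. g (x n)) N) \<le> e"
proof -
  have "norm (integral {0..1} (\<lambda>u. f u - g u)) \<le> integral {0..1::real} (\<lambda>_. e)"
    using f g close unfolding averages_to_integral_def
    by (intro Henstock_Kurzweil_Integration.integral_norm_bound_integral
          Henstock_Kurzweil_Integration.integrable_diff) auto
  then show "norm (integral {0..1} g - integral {0..1} f) \<le> e"
    using f g by (simp add: averages_to_integral_def norm_minus_commute
        Henstock_Kurzweil_Integration.integral_diff)
  have "cesaro_mean (\<lambda>n. f (x n)) N - cesaro_mean (\<lambda>n. g (x n)) N
      = cesaro_mean (\<lambda>n. f (x n) - g (x n)) N"
    by (simp add: cesaro_mean_def sum_subtractf scaleR_right_diff_distrib)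
  then show "norm (cesaro_mean (\<lambda>n. f (x n)) N - cesaro_mean (\<lambda>n. g (x n)) N) \<le> e"
    by (simp add: norm_cesaro_mean_le close)
qed

lemma averages_to_integral_uniform_limit:
  assumes approx: "\<And>e. e > 0 \<Longrightarrow> \<exists>g. averages_to_integral x g \<and> (\<forall>u. norm (f u - g u) \<le> e)"
  shows "averages_to_integral x f"
  unfolding averages_to_integral_def
proof
  have "\<exists>g. (\<forall>u\<in>cbox 0 1. norm (f u - g u) \<le> e) \<and> g integrable_on cbox 0 1" if "e > 0" for e
    using approx[OF that] by (auto simp: averages_to_integral_def)
  from integrable_uniform_limit[OF this] show f: "f integrable_on {0..1}" by simp
  show "cesaro_mean (\<lambda>n. f (x n)) \<longlonglongrightarrow> integral {0..1} f"
  proof (rule LIMSEQ_I)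
    fix \<epsilon> :: real assume "\<epsilon> > 0"
    define e where "e = \<epsilon> / 4"
    have "e > 0" using \<open>\<epsilon> > 0\<close> by (simp add: e_def)
    then obtain g where g: "averages_to_integral x g" and "\<And>u. norm (f u - g u) \<le> e"
      using approx by blast
    note close = averages_to_integral_close[OF f this]
    from g \<open>e > 0\<close> obtain N0 where
      N0: "\<And>N. N \<ge> N0 \<Longrightarrow> norm (cesaro_mean (\<lambda>n. g (x n)) N - integral {0..1} g) < e"
      unfolding averages_to_integral_def LIMSEQ_iff by blast
    have "norm (cesaro_mean (\<lambda>n. f (x n)) N - integral {0..1} f) < \<epsilon>" if "N \<ge> N0" for N
      using norm_diff_triangle_le[OF norm_diff_triangle_le[OF close(2) less_imp_le[OF N0[OF that]]]
          close(1)] \<open>\<epsilon> > 0\<close>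
      by (simp add: e_def)
    then show "\<exists>N0. \<forall>N\<ge>N0. norm (cesaro_mean (\<lambda>n. f (x n)) N - integral {0..1} f) < \<epsilon>"
      by blast
  qed
qed

inductive trig_poly :: "(real \<Rightarrow> complex) \<Rightarrow> bool" where
  trig_poly_term: "trig_poly (\<lambda>u. c * cis (2 * pi * of_int k * u))"
| trig_poly_add: "trig_poly f \<Longrightarrow> trig_poly g \<Longrightarrow> trig_poly (\<lambda>u. f u + g u)"

lemma trig_poly_mult:
  assumes "trig_poly f" "trig_poly g"
  shows "trig_poly (\<lambda>u. f u * g u)"
  using assms
proof (induction f)
  case (trig_poly_term c k)
  from trig_poly_term.prems show ?case
  proof (induction g)
    case (trig_poly_term d l)
    have "(\<lambda>u. c * cis (2 * pi * of_int k * u) * (d * cis (2 * pi * of_int l * u)))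
        = (\<lambda>u. (c * d) * cis (2 * pi * of_int (k + l) * u))"
      by (simp add: fun_eq_iff cis_mult[symmetric] distrib_left distrib_right)
    then show ?case by (simp only: trig_poly.trig_poly_term)
  next
    case (trig_poly_add f g)
    then show ?case by (simp only: distrib_left trig_poly.trig_poly_add)
  qed
next
  case (trig_poly_add f1 f2)
  then show ?case by (simp only: distrib_right trig_poly.trig_poly_add)
qed

lemma trig_poly_real_polynomial:
  fixes p :: "complex \<Rightarrow> real"
  assumes "real_polynomial_function p"
  shows "trig_poly (\<lambda>u. of_real (p (cis (2 * pi * u))))"
  using assms
proof (induction p)
  case (linear p)
  then interpret bounded_linear p .
  define c where "c = Complex (p 1 / 2) (- p \<i> / 2)"
  have p: "p z = Re z * p 1 + Im z * p \<i>" for z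
  proof -
    have "z = Re z *\<^sub>R 1 + Im z *\<^sub>R \<i>" by (simp add: complex_eq_iff)
    then have "p z = p (Re z *\<^sub>R 1 + Im z *\<^sub>R \<i>)" by (rule arg_cong)
    then show ?thesis by (simp only: add scaleR real_scaleR_def)
  qed
  have "(\<lambda>u. complex_of_real (p (cis (2 * pi * u))))
      = (\<lambda>u. c * cis (2 * pi * of_int 1 * u) + cnj c * cis (2 * pi * of_int (- 1) * u))"
    by (simp add: fun_eq_iff complex_eq_iff p[of "cis _"] c_def algebra_simps)
  then show ?case by (simp only: trig_poly.intros)
next
  case (const c)
  show ?case using trig_poly_term[of "of_real c" 0] by simp
next
  case (add f g)
  then show ?case by (simp add: trig_poly.trig_poly_add)
next
  case (mult f g)
  then show ?case by (simp add: trig_poly_mult)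
qed

lemma has_integral_cis_period:
  "((\<lambda>u. cis (2 * pi * of_int k * u)) has_integral of_bool (k = 0)) {0..1::real}"
proof (cases "k = 0")
  case True
  then show ?thesis using has_integral_const_real[of "1 :: complex" 0 1] by simp
next
  case False
  define w where "w = 2 * pi * of_int k"
  have w: "w \<noteq> 0" using False by (simp add: w_def)
  have "((\<lambda>u. cis (w * u)) has_integral
      cis (w * 1) / (\<i> * of_real w) - cis (w * 0) / (\<i> * of_real w)) {0..1}"
    by (rule fundamental_theorem_of_calculus)
      (use w in \<open>auto intro!: derivative_eq_intros
         simp: has_vector_derivative_def fun_eq_iff scaleR_conv_of_real field_simps\<close>)
  moreover have "cis (w * 1) = 1"
    using cis_multiple_2pi[of "of_int k"] by (simp add: w_def)
  ultimately show ?thesis using False by (simp add: w_def)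
qed

lemma cis_2pi_eq_iff: "cis (2 * pi * u) = cis (2 * pi * v) \<longleftrightarrow> u - v \<in> \<int>"
proof -
  have "cis (2 * pi * u) = cis (2 * pi * v) \<longleftrightarrow> (\<exists>n::int. 2 * pi * u = 2 * pi * v + 2 * pi * n)"
    using sin_cos_eq_iff by (auto simp: complex_eq_iff)
  moreover have "2 * pi * u = 2 * pi * v + 2 * pi * n \<longleftrightarrow> u - v = n" for n :: int
  proof -
    have "2 * pi * u = 2 * pi * v + 2 * pi * n \<longleftrightarrow> 2 * pi * (u - v) = 2 * pi * n"
      by (auto simp: algebra_simps)
    then show ?thesis by simp
  qed
  ultimately show ?thesis by (auto simp: Ints_def)
qed

lemma cis_2pi_notin_arc_iff:
  assumes "0 \<le> a" "a \<le> b" "b \<le> 1"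
  shows "cis (2 * pi * u) \<notin> (\<lambda>v. cis (2 * pi * v)) ` ({0..a} \<union> {b..1}) \<longleftrightarrow> a < frac u \<and> frac u < b"
proof -
  define w where "w = frac u"
  have frac: "0 \<le> w" "w < 1" by (simp_all add: w_def frac_lt_1)
  have cis_eq_iff: "cis (2 * pi * u) = cis (2 * pi * v) \<longleftrightarrow> v = w \<or> v = 1 \<and> w = 0"
    if "v \<in> {0..a} \<union> {b..1}" for v
  proof -
    have v: "0 \<le> v" "v \<le> 1" using that assms by auto
    then have range: "- 1 \<le> w - v" "w - v < 1" using frac by linarith+
    have "cis (2 * pi * u) = cis (2 * pi * w)"
      by (simp add: cis_2pi_eq_iff w_def frac_def)
    then have "cis (2 * pi * u) = cis (2 * pi * v) \<longleftrightarrow> w - v \<in> \<int>"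
      by (simp only: flip: cis_2pi_eq_iff)
    also have "\<dots> \<longleftrightarrow> w - v = 0 \<or> w - v = - 1"
    proof
      assume "w - v \<in> \<int>"
      then obtain n where n: "w - v = of_int n" by (rule Ints_cases)
      then have "n = 0 \<or> n = - 1" using range by linarith
      with n show "w - v = 0 \<or> w - v = - 1" by auto
    qed (metis Ints_0 Ints_1 Ints_minus)
    finally show ?thesis using frac v by linarith
  qed
  have "cis (2 * pi * u) \<in> (\<lambda>v. cis (2 * pi * v)) ` ({0..a} \<union> {b..1})
      \<longleftrightarrow> (\<exists>v\<in>{0..a} \<union> {b..1}. v = w \<or> v = 1 \<and> w = 0)"
    unfolding image_iff by (intro bex_cong refl cis_eq_iff)
  also have "\<dots> \<longleftrightarrow> w \<in> {0..a} \<union> {b..1}" using assms by auto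
  also have "\<dots> \<longleftrightarrow> \<not> (a < w \<and> w < b)" using frac by auto
  finally show ?thesis unfolding w_def by blast
qed

lemma tendsto_of_bool_notin_closed:
  assumes C: "closed C" "C \<noteq> {}"
  shows "(\<lambda>m. min 1 (real m * infdist z C)) \<longlonglongrightarrow> of_bool (z \<notin> C)"
proof (cases "z \<in> C")
  case False
  then have "0 < infdist z C" using C by (simp add: infdist_pos_not_in_closed)
  then have "filterlim (\<lambda>m. real m * infdist z C) at_top sequentially"
    by (intro filterlim_at_top_mult_tendsto_pos[OF tendsto_const _ filterlim_real_sequentially])
  then have "\<forall>\<^sub>F m in sequentially. 1 \<le> real m * infdist z C"
    by (simp add: filterlim_at_top)
  then have "\<forall>\<^sub>F m in sequentially. min 1 (real m * infdist z C) = 1"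
    by eventually_elim simp
  then show ?thesis using False by (simp add: tendsto_eventually)
qed simp

locale weyl_sequence =
  fixes x :: "nat \<Rightarrow> real"
  assumes exponential_means: "\<And>h::nat. 0 < h \<Longrightarrow> cesaro_mean (\<lambda>n. cis (2 * pi * real h * x n)) \<longlonglongrightarrow> 0"
begin

lemma exponential_means_int:
  "cesaro_mean (\<lambda>n. cis (2 * pi * of_int k * x n)) \<longlonglongrightarrow> of_bool (k = 0)"
proof -
  consider "k = 0" | "k > 0" | "k < 0" by linarith
  then show ?thesis
  proof cases
    assume k: "k = 0"
    have "\<forall>\<^sub>F N in sequentially. cesaro_mean (\<lambda>n. cis (2 * pi * of_int k * x n)) N = 1"
      using eventually_gt_at_top[of 0]
      by eventually_elim (simp add: k cesaro_mean_def scaleR_conv_of_real)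
    then show ?thesis using k by (simp add: tendsto_eventually)
  next
    assume "k > 0"
    then show ?thesis using exponential_means[of "nat k"] by simp
  next
    assume "k < 0"
    have "(\<lambda>N. cnj (cesaro_mean (\<lambda>n. cis (2 * pi * nat (- k) * x n)) N)) \<longlonglongrightarrow> cnj 0"
      using \<open>k < 0\<close> by (intro tendsto_cnj exponential_means) auto
    moreover have "cnj (cesaro_mean (\<lambda>n. cis (2 * pi * nat (- k) * x n)) N)
        = cesaro_mean (\<lambda>n. cis (2 * pi * of_int k * x n)) N" for N
      using \<open>k < 0\<close> by (simp add: cesaro_mean_def cis_cnj)
    ultimately show ?thesis using \<open>k < 0\<close> by simp
  qed
qed

lemma averages_to_integral_trig_poly: "trig_poly f \<Longrightarrow> averages_to_integral x f"
proof (induction rule: trig_poly.induct)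
  case (trig_poly_term c k)
  have "averages_to_integral x (\<lambda>u. cis (2 * pi * of_int k * u))"
    using has_integral_cis_period[of k] exponential_means_int[of k]
    by (auto simp: averages_to_integral_def integrable_on_def integral_unique)
  then show ?case
    by (rule averages_to_integral_bounded_linear) (rule bounded_linear_mult_right)
qed (rule averages_to_integral_add)

lemma averages_to_integral_continuous_on_circle:
  fixes F :: "complex \<Rightarrow> real"
  assumes F: "continuous_on (sphere 0 1) F"
  shows "averages_to_integral x (\<lambda>u. F (cis (2 * pi * u)))"
proof (rule averages_to_integral_uniform_limit)
  fix e :: real assume "e > 0"
  then obtain p where p: "real_polynomial_function p" "\<And>z. z \<in> sphere 0 1 \<Longrightarrow> \<bar>F z - p z\<bar> < e"
    using Stone_Weierstrass_real_polynomial_function[OF compact_sphere F] by blast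
  have "averages_to_integral x (\<lambda>u. p (cis (2 * pi * u)))"
    using averages_to_integral_bounded_linear[OF
        averages_to_integral_trig_poly[OF trig_poly_real_polynomial[OF p(1)]] bounded_linear_Re]
    by simp
  moreover have "\<bar>F (cis u) - p (cis u)\<bar> \<le> e" for u
    using p(2)[of "cis u"] by simp
  ultimately show "\<exists>g. averages_to_integral x g \<and> (\<forall>u. norm (F (cis (2 * pi * u)) - g u) \<le> e)"
    by auto
qed

text \<open>The half of the portmanteau theorem for open sets; applied to two complementary arcs it
  bounds a frequency from both sides.\<close>

lemma eventually_frequency_notin_closed_gt:
  fixes e :: real
  assumes C: "closed C" "C \<noteq> {}"
    and e: "e < integral {0..1} (\<lambda>u. of_bool (cis (2 * pi * u) \<notin> C))"
  shows "\<forall>\<^sub>F N in sequentially. e < frequency (\<lambda>n. cis (2 * pi * x n) \<notin> C) N"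
proof -
  define F where "F m z = min 1 (real m * infdist z C)" for m z
  have F_lim: "(\<lambda>m. F m z) \<longlonglongrightarrow> of_bool (z \<notin> C)" for z
    unfolding F_def by (rule tendsto_of_bool_notin_closed[OF C])
  have F_le: "F m z \<le> of_bool (z \<notin> C)" for m z by (simp add: F_def)
  have F_averages: "averages_to_integral x (\<lambda>u. F m (cis (2 * pi * u)))" for m
    unfolding F_def by (intro averages_to_integral_continuous_on_circle continuous_intros)
  have "(\<lambda>m. integral {0..1} (\<lambda>u. F m (cis (2 * pi * u))))
      \<longlonglongrightarrow> integral {0..1} (\<lambda>u. of_bool (cis (2 * pi * u) \<notin> C))"
  proof (rule dominated_convergence(2))
    show "(\<lambda>_. 1::real) integrable_on {0..1::real}" by (rule integrable_const_ivl)
  qed (use F_averages F_lim in \<open>auto simp: averages_to_integral_def F_def infdist_nonneg\<close>)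
  then have "\<forall>\<^sub>F m in sequentially. e < integral {0..1} (\<lambda>u. F m (cis (2 * pi * u)))"
    using e by (rule order_tendstoD(1))
  then obtain m where "e < integral {0..1} (\<lambda>u. F m (cis (2 * pi * u)))"
    by (auto simp: eventually_sequentially)
  with F_averages[of m]
  have "\<forall>\<^sub>F N in sequentially. e < cesaro_mean (\<lambda>n. F m (cis (2 * pi * x n))) N"
    by (auto simp: averages_to_integral_def intro: order_tendstoD(1))
  then show ?thesis
  proof eventually_elim
    case (elim N)
    also have "cesaro_mean (\<lambda>n. F m (cis (2 * pi * x n))) N
        \<le> frequency (\<lambda>n. cis (2 * pi * x n) \<notin> C) N"
      unfolding frequency_eq_cesaro_mean cesaro_mean_def
      by (intro scaleR_left_mono sum_mono F_le) simp
    finally show ?case .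
  qed
qed

lemma eventually_arc_frequency_gt:
  assumes ab: "0 \<le> a" "a \<le> b" "b \<le> 1" and e: "e < b - a"
  shows "\<forall>\<^sub>F N in sequentially. e < frequency (\<lambda>n. a < frac (x n) \<and> frac (x n) < b) N"
proof -
  let ?C = "(\<lambda>v. cis (2 * pi * v)) ` ({0..a} \<union> {b..1})"
  have "closed ?C"
    by (intro compact_imp_closed compact_continuous_image continuous_intros compact_Un compact_Icc)
  moreover have "?C \<noteq> {}" using ab by simp
  moreover have "integral {0..1} (\<lambda>u. of_bool (cis (2 * pi * u) \<notin> ?C)) = b - a"
  proof -
    have "integral {0..1} (\<lambda>u. of_bool (cis (2 * pi * u) \<notin> ?C))
        = integral {0..1} (\<lambda>u. if u \<in> {a<..<b} then 1 else 0 :: real)"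
    proof (rule integral_cong)
      fix u :: real assume "u \<in> {0..1}"
      then have "frac u = u \<or> u = 1 \<and> frac u = 0" by (auto simp: frac_eq)
      then show "of_bool (cis (2 * pi * u) \<notin> ?C) = (if u \<in> {a<..<b} then 1 else 0 :: real)"
        using ab by (auto simp: cis_2pi_notin_arc_iff[OF ab])
    qed
    also have "\<dots> = integral ({a<..<b} \<inter> {0..1}) (\<lambda>_. 1)"
      by (rule integral_restrict_Int)
    also have "{a<..<b} \<inter> {0..1} = {a<..<b}" using ab by auto
    also have "integral {a<..<b} (\<lambda>_. 1) = b - a"
      using ab by (simp flip: integral_open_interval_real)
    finally show ?thesis .
  qed
  ultimately have "\<forall>\<^sub>F N in sequentially. e < frequency (\<lambda>n. cis (2 * pi * x n) \<notin> ?C) N"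
    using e by (intro eventually_frequency_notin_closed_gt) simp_all
  then show ?thesis by (simp only: cis_2pi_notin_arc_iff[OF ab])
qed

theorem weyl_criterion: "uniformly_distributed_mod1 x"
  unfolding uniformly_distributed_mod1_def
proof (intro allI impI)
  fix t :: real assume t: "0 \<le> t \<and> t < 1"
  show "frequency (\<lambda>n. frac (x n) \<le> t) \<longlonglongrightarrow> t"
  proof (rule order_tendstoI)
    fix l assume "l < t"
    with t have "\<forall>\<^sub>F N in sequentially. l < frequency (\<lambda>n. 0 < frac (x n) \<and> frac (x n) < t) N"
      by (intro eventually_arc_frequency_gt) auto
    then show "\<forall>\<^sub>F N in sequentially. l < frequency (\<lambda>n. frac (x n) \<le> t) N"
    proof eventually_elim
      case (elim N)
      also have "frequency (\<lambda>n. 0 < frac (x n) \<and> frac (x n) < t) N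
          \<le> frequency (\<lambda>n. frac (x n) \<le> t) N"
        by (rule frequency_mono) simp
      finally show ?case .
    qed
  next
    fix l assume "t < l"
    with t have "\<forall>\<^sub>F N in sequentially. 1 - l < frequency (\<lambda>n. t < frac (x n) \<and> frac (x n) < 1) N"
      by (intro eventually_arc_frequency_gt) auto
    then show "\<forall>\<^sub>F N in sequentially. frequency (\<lambda>n. frac (x n) \<le> t) N < l"
      using eventually_gt_at_top[of 0]
    proof eventually_elim
      case (elim N)
      then have "1 - l < frequency (\<lambda>n. \<not> frac (x n) \<le> t) N" by (simp add: frac_lt_1 not_le)
      then show ?case using elim(2) by (simp add: frequency_not)
    qed
  qed
qed

end

section \<open>Benford sequences\<close>

lemma significand_eq_powr_frac:
  assumes "y \<noteq> 0"
  shows "significand y = 10 powr frac (log 10 \<bar>y\<bar>)"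
  unfolding significand_def
proof (rule the_equality)
  let ?l = "log 10 \<bar>y\<bar>"
  have "\<bar>y\<bar> = 10 powr of_int \<lfloor>?l\<rfloor> * 10 powr frac ?l"
    using assms by (simp add: frac_def flip: powr_add)
  moreover have "10 powr frac ?l < 10 powr 1" by (intro powr_less_mono frac_lt_1) simp
  moreover have "10 powr 0 \<le> 10 powr frac ?l" by (intro powr_mono frac_ge_0) simp
  ultimately show "1 \<le> 10 powr frac ?l \<and> 10 powr frac ?l < 10 \<and>
      (\<exists>k::int. \<bar>y\<bar> = 10 powr of_int k * 10 powr frac ?l)"
    by auto
next
  fix t :: real assume t: "1 \<le> t \<and> t < 10 \<and> (\<exists>k::int. \<bar>y\<bar> = 10 powr of_int k * t)"
  then obtain k :: int where "\<bar>y\<bar> = 10 powr of_int k * t" by blast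
  then have "log 10 \<bar>y\<bar> = of_int k + log 10 t" using t by (simp add: log_mult)
  moreover have "0 \<le> log 10 t" "log 10 t < 1" using t by auto
  ultimately have "frac (log 10 \<bar>y\<bar>) = log 10 t" by (simp add: frac_unique_iff)
  then show "t = 10 powr frac (log 10 \<bar>y\<bar>)" using t by simp
qed

theorem benford_iff_uniformly_distributed_log:
  "benford x \<longleftrightarrow> (\<forall>n\<ge>1. x n \<noteq> 0) \<and> uniformly_distributed_mod1 (\<lambda>n. log 10 \<bar>x n\<bar>)"
proof (cases "\<forall>n\<ge>1. x n \<noteq> 0")
  case True
  have "(significand (x n) \<le> 10 powr t) = (frac (log 10 \<bar>x n\<bar>) \<le> t)" if "1 \<le> n" for n t
    using True that by (simp add: significand_eq_powr_frac)
  then have "frequency (\<lambda>n. frac (log 10 \<bar>x n\<bar>) \<le> t)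
      = frequency (\<lambda>n. significand (x n) \<le> 10 powr t)" for t
    unfolding frequency_def by (auto intro!: ext arg_cong[where f = "\<lambda>A. real (card A) / _"])
  then have "uniformly_distributed_mod1 (\<lambda>n. log 10 \<bar>x n\<bar>) \<longleftrightarrow>
      (\<forall>t. 0 \<le> t \<and> t < 1 \<longrightarrow> frequency (\<lambda>n. significand (x n) \<le> 10 powr t) \<longlonglongrightarrow> t)"
    by (simp only: uniformly_distributed_mod1_def)
  also have "\<dots> \<longleftrightarrow>
      (\<forall>t. 1 \<le> t \<and> t < 10 \<longrightarrow> frequency (\<lambda>n. significand (x n) \<le> t) \<longlonglongrightarrow> log 10 t)"
    (is "(\<forall>t. _ \<longrightarrow> ?freq (10 powr t) \<longlonglongrightarrow> t) \<longleftrightarrow> _")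
  proof (intro iffI allI impI)
    fix t :: real
    assume "\<forall>t. 0 \<le> t \<and> t < 1 \<longrightarrow> ?freq (10 powr t) \<longlonglongrightarrow> t" and "1 \<le> t \<and> t < 10"
    then show "?freq t \<longlonglongrightarrow> log 10 t" by (auto dest: spec[of _ "log 10 t"])
  next
    fix t :: real
    assume "\<forall>t. 1 \<le> t \<and> t < 10 \<longrightarrow> ?freq t \<longlonglongrightarrow> log 10 t" and "0 \<le> t \<and> t < 1"
    moreover from this have "1 \<le> 10 powr t" "10 powr t < 10"
      using powr_mono[of 0 t 10] powr_less_mono[of t 1 10] by auto
    ultimately show "?freq (10 powr t) \<longlonglongrightarrow> t" by (auto dest: spec[of _ "10 powr t"])
  qed
  finally show ?thesis using True by (simp add: benford_def frequency_def[abs_def])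
qed (auto simp: benford_def)

section \<open>Averaging over the next digit\<close>

text \<open>The index \<open>k\<close> stands for the partial quotient \<open>k + 1\<close>.\<close>

definition gauss_branch :: "nat \<Rightarrow> real \<Rightarrow> real" where
  "gauss_branch k r = 1 / (real k + 1 + r)"

definition digit_weight :: "nat \<Rightarrow> real \<Rightarrow> real" where
  "digit_weight k r = (1 + r) / ((real k + 1 + r) * (real k + 2 + r))"

definition digit_mean :: "real \<Rightarrow> (nat \<Rightarrow> 'a::real_normed_vector) \<Rightarrow> 'a" where
  "digit_mean r g = (\<Sum>k. digit_weight k r *\<^sub>R g k)"

lemma gauss_branch_mem: "0 \<le> r \<Longrightarrow> gauss_branch k r \<in> {0..1}"
  by (auto simp: gauss_branch_def field_simps)

lemma digit_weight_nonneg: "0 \<le> r \<Longrightarrow> 0 \<le> digit_weight k r"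
  by (simp add: digit_weight_def)

lemma digit_weight_0_le_half:
  assumes "0 \<le> r"
  shows "digit_weight 0 r \<le> 1 / 2"
proof -
  have "digit_weight 0 r = 1 / (2 + r)" using assms by (simp add: digit_weight_def)
  also have "\<dots> \<le> 1 / 2" using assms by (intro divide_left_mono) auto
  finally show ?thesis .
qed

lemma digit_weight_ge:
  assumes r: "r \<in> {0..1}"
  shows "1 / ((real k + 2) * (real k + 3)) \<le> digit_weight k r"
  unfolding digit_weight_def using r by (intro frac_le mult_mono mult_pos_pos) auto

lemma digit_weight_sums:
  assumes "0 \<le> r"
  shows "(\<lambda>k. digit_weight k r) sums 1"
proof -
  define tail where "tail k = (1 + r) / ((1 + r) + real k)" for k
  have "filterlim (\<lambda>k. (1 + r) + real k) at_top sequentially"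
    by (rule filterlim_tendsto_add_at_top[OF tendsto_const filterlim_real_sequentially])
  then have "tail \<longlonglongrightarrow> 0"
    unfolding tail_def
    by (intro tendsto_divide_0[OF tendsto_const] filterlim_at_top_imp_at_infinity)
  then have "(\<lambda>k. tail k - tail (Suc k)) sums (tail 0 - 0)"
    by (rule telescope_sums')
  moreover have "tail k - tail (Suc k) = digit_weight k r" for k
    using assms by (simp add: tail_def digit_weight_def divide_simps) (simp add: algebra_simps)
  ultimately show ?thesis using assms by (simp add: tail_def)
qed

lemma digit_mean_sums:
  fixes g :: "nat \<Rightarrow> 'a::banach"
  assumes "0 \<le> r" and "\<And>k. norm (g k) \<le> B"
  shows "(\<lambda>k. digit_weight k r *\<^sub>R g k) sums digit_mean r g"
proof -
  have "summable (\<lambda>k. digit_weight k r * B)"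
    using digit_weight_sums[OF assms(1)] by (intro summable_mult2) (auto simp: sums_iff)
  then have "summable (\<lambda>k. digit_weight k r *\<^sub>R g k)"
    by (rule summable_comparison_test'[where N = 0])
      (auto simp: digit_weight_nonneg assms intro!: mult_left_mono)
  then show ?thesis unfolding digit_mean_def by (rule summable_sums)
qed

lemma norm_digit_mean_le:
  fixes g :: "nat \<Rightarrow> 'a::banach"
  assumes "0 \<le> r" and "\<And>k. norm (g k) \<le> B"
  shows "norm (digit_mean r g) \<le> B"
proof (rule norm_sums_le[OF digit_mean_sums[OF assms]])
  show "(\<lambda>k. digit_weight k r * B) sums B"
    using sums_mult2[OF digit_weight_sums[OF assms(1)], of B] by simp
qed (simp add: digit_weight_nonneg assms mult_left_mono)

lemma digit_mean_diff:
  fixes g h :: "nat \<Rightarrow> 'a::banach"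
  assumes "0 \<le> r" "\<And>k. norm (g k) \<le> B" "\<And>k. norm (h k) \<le> B"
  shows "digit_mean r (\<lambda>k. g k - h k) = digit_mean r g - digit_mean r h"
  using sums_diff[OF digit_mean_sums[OF assms(1,2)] digit_mean_sums[OF assms(1,3)]]
  by (simp add: digit_mean_def sums_iff scaleR_right_diff_distrib)

lemma norm_digit_mean_le_midpoint:
  fixes g :: "nat \<Rightarrow> 'a::banach"
  assumes r: "0 \<le> r" and first: "norm (g 0) \<le> A" and later: "\<And>k. 0 < k \<Longrightarrow> norm (g k) \<le> B"
    and "B \<le> A"
  shows "norm (digit_mean r g) \<le> (A + B) / 2"
proof -
  have g: "norm (g k) \<le> (if k = 0 then A else B)" for k
    using first later by simp
  have "norm (digit_mean r g) \<le> B + digit_weight 0 r * (A - B)"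
  proof (rule norm_sums_le)
    show "(\<lambda>k. digit_weight k r *\<^sub>R g k) sums digit_mean r g"
    proof (rule digit_mean_sums[OF r])
      show "norm (g k) \<le> A" for k using g[of k] \<open>B \<le> A\<close> by (auto split: if_splits)
    qed
    show "(\<lambda>k. digit_weight k r * B + (if k = 0 then digit_weight k r * (A - B) else 0))
        sums (B + digit_weight 0 r * (A - B))"
      using sums_add[OF sums_mult2[OF digit_weight_sums[OF r], of B] sums_single] by simp
    show "norm (digit_weight k r *\<^sub>R g k)
        \<le> digit_weight k r * B + (if k = 0 then digit_weight k r * (A - B) else 0)" for k
      using mult_left_mono[OF g[of k] digit_weight_nonneg[OF r, of k]]
      by (auto simp: digit_weight_nonneg[OF r] algebra_simps)
  qed
  also have "\<dots> \<le> B + 1 / 2 * (A - B)"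
    using \<open>B \<le> A\<close> digit_weight_0_le_half[OF r] by (intro add_left_mono mult_right_mono) auto
  finally show ?thesis by (simp add: field_simps)
qed

lemma norm_digit_mean_le_pair:
  fixes g :: "nat \<Rightarrow> 'a::banach"
  assumes r: "0 \<le> r" and g: "\<And>k. norm (g k) \<le> B" and "i \<noteq> j"
    and m: "m \<le> digit_weight i r" "m \<le> digit_weight j r" "0 \<le> m"
  shows "norm (digit_mean r g) \<le> (1 - 2 * m) * B + m * norm (g i + g j)"
proof -
  define p where "p k = digit_weight k r - (if k \<in> {i, j} then m else 0)" for k
  have p: "0 \<le> p k" for k using m digit_weight_nonneg[OF r] by (simp add: p_def)
  have "norm (digit_mean r g - (\<Sum>k\<in>{i, j}. m *\<^sub>R g k)) \<le> (1 - (\<Sum>k\<in>{i, j}. m)) * B"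
  proof (rule norm_sums_le)
    have "p k *\<^sub>R g k = digit_weight k r *\<^sub>R g k - (if k \<in> {i, j} then m *\<^sub>R g k else 0)" for k
      by (simp add: p_def scaleR_left_diff_distrib)
    then show "(\<lambda>k. p k *\<^sub>R g k) sums (digit_mean r g - (\<Sum>k\<in>{i, j}. m *\<^sub>R g k))"
      using sums_diff[OF digit_mean_sums[OF r g] sums_If_finite_set[of "{i, j}" "\<lambda>k. m *\<^sub>R g k"]]
      by (simp only: finite.intros simp_thms)
    show "(\<lambda>k. p k * B) sums ((1 - (\<Sum>k\<in>{i, j}. m)) * B)"
      unfolding p_def
      by (intro sums_mult2 sums_diff digit_weight_sums r sums_If_finite_set) simp
    show "norm (p k *\<^sub>R g k) \<le> p k * B" for k
      using p g by (simp add: mult_left_mono)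
  qed
  then have "norm (digit_mean r g - m *\<^sub>R (g i + g j)) \<le> (1 - 2 * m) * B"
    using \<open>i \<noteq> j\<close> by (simp add: scaleR_right_distrib)
  moreover have "norm (m *\<^sub>R (g i + g j)) = m * norm (g i + g j)" using m by simp
  ultimately show ?thesis
    using norm_triangle_ineq2[of "digit_mean r g" "m *\<^sub>R (g i + g j)"] by linarith
qed

lemma digit_weight_has_derivative:
  assumes "0 \<le> x"
  shows "(digit_weight k has_real_derivative
    digit_weight k x * (1 / (1 + x) - (1 / (real k + 1 + x) + 1 / (real k + 2 + x))))
    (at x within S)"
proof -
  have "1 + x \<noteq> 0" "real k + 1 + x \<noteq> 0" "real k + 2 + x \<noteq> 0" using assms by auto
  then show ?thesis
    unfolding digit_weight_def
    by (auto intro!: derivative_eq_intros) (simp add: divide_simps; simp add: algebra_simps)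
qed

lemma digit_weight_lipschitz: "(2 * digit_weight k 0)-lipschitz_on {0..1} (digit_weight k)"
proof (rule lipschitz_onI)
  fix r s :: real assume rs: "r \<in> {0..1}" "s \<in> {0..1}"
  define d where "d x = 1 / (1 + x) - (1 / (real k + 1 + x) + 1 / (real k + 2 + x))" for x
  have "norm (digit_weight k r - digit_weight k s) \<le> (2 * digit_weight k 0) * norm (r - s)"
  proof (rule field_differentiable_bound[where f' = "\<lambda>x. digit_weight k x * d x" and S = "{0..1}"])
    fix x :: real assume x: "x \<in> {0..1}"
    then show "(digit_weight k has_real_derivative digit_weight k x * d x) (at x within {0..1})"
      unfolding d_def by (intro digit_weight_has_derivative) simp
    have "1 / (real k + 1 + x) \<le> 1 / (1 + x)" "1 / (real k + 2 + x) \<le> 1" "1 / (1 + x) \<le> 1"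
      "0 < 1 / (real k + 1 + x)" "0 < 1 / (real k + 2 + x)"
      using x by (auto intro: divide_left_mono)
    then have "\<bar>d x\<bar> \<le> 1" unfolding d_def by linarith
    then have "norm (digit_weight k x * d x) \<le> digit_weight k x"
      using x by (simp add: abs_mult digit_weight_nonneg mult_left_le)
    also have "digit_weight k x \<le> 2 / ((real k + 1) * (real k + 2))"
      unfolding digit_weight_def using x by (intro frac_le mult_mono mult_pos_pos) auto
    finally show "norm (digit_weight k x * d x) \<le> 2 * digit_weight k 0"
      by (simp add: digit_weight_def)
  qed (use rs in auto)
  then show "dist (digit_weight k r) (digit_weight k s) \<le> 2 * digit_weight k 0 * dist r s"
    by (simp add: dist_norm)
qed (simp add: digit_weight_nonneg)

lemma norm_digit_mean_diff_le:
  fixes g :: "nat \<Rightarrow> 'a::banach"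
  assumes r: "r \<in> {0..1}" and s: "s \<in> {0..1}" and g: "\<And>k. norm (g k) \<le> B"
  shows "norm (digit_mean r g - digit_mean s g) \<le> 2 * B * \<bar>r - s\<bar>"
proof (rule norm_sums_le)
  show "(\<lambda>k. digit_weight k r *\<^sub>R g k - digit_weight k s *\<^sub>R g k)
      sums (digit_mean r g - digit_mean s g)"
    using r s g by (intro sums_diff digit_mean_sums[where B = B]) auto
  show "(\<lambda>k. digit_weight k 0 * (2 * B * \<bar>r - s\<bar>)) sums (2 * B * \<bar>r - s\<bar>)"
    using sums_mult2[OF digit_weight_sums[of 0], of "2 * B * \<bar>r - s\<bar>"] by simp
  show "norm (digit_weight k r *\<^sub>R g k - digit_weight k s *\<^sub>R g k)
      \<le> digit_weight k 0 * (2 * B * \<bar>r - s\<bar>)" for k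
  proof -
    have "norm (digit_weight k r *\<^sub>R g k - digit_weight k s *\<^sub>R g k)
        = \<bar>digit_weight k r - digit_weight k s\<bar> * norm (g k)"
      by (simp flip: scaleR_left_diff_distrib)
    also have "\<dots> \<le> (2 * digit_weight k 0 * \<bar>r - s\<bar>) * B"
      using lipschitz_onD[OF digit_weight_lipschitz r s, of k] g[of k] digit_weight_nonneg[of 0 k]
      by (intro mult_mono) (auto simp: dist_real_def)
    finally show ?thesis by (simp add: mult_ac)
  qed
qed

section \<open>The twisted transfer operator\<close>

definition digit_phase :: "real \<Rightarrow> nat \<Rightarrow> real \<Rightarrow> complex" where
  "digit_phase \<alpha> k r = cis (\<alpha> * ln (real k + 1 + r))"

definition twisted_branch :: "real \<Rightarrow> (real \<Rightarrow> complex) \<Rightarrow> real \<Rightarrow> nat \<Rightarrow> complex" where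
  "twisted_branch \<alpha> f r k = digit_phase \<alpha> k r * f (gauss_branch k r)"

definition twisted_transfer :: "real \<Rightarrow> (real \<Rightarrow> complex) \<Rightarrow> real \<Rightarrow> complex" where
  "twisted_transfer \<alpha> f r = digit_mean r (twisted_branch \<alpha> f r)"

definition lipschitz_class :: "real \<Rightarrow> real \<Rightarrow> (real \<Rightarrow> complex) set" where
  "lipschitz_class L M = {f. (\<forall>r\<in>{0..1}. cmod (f r) \<le> M) \<and> (L * M)-lipschitz_on {0..1} f}"

lemma cmod_cis_diff_le: "cmod (cis x - cis y) \<le> \<bar>x - y\<bar>"
proof -
  have "cis x - cis y = cis y * (cis (x - y) - 1)"
    by (simp add: cis_mult algebra_simps)
  then have "cmod (cis x - cis y) = cmod (cis (x - y) - 1)"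
    by (simp only: norm_mult norm_cis mult_1)
  also have "\<dots> = 2 * \<bar>sin ((x - y) / 2)\<bar>"
    unfolding cis_conv_exp by (rule dist_exp_i_1)
  also have "\<dots> \<le> \<bar>x - y\<bar>" using abs_sin_x_le_abs_x[of "(x - y) / 2"] by simp
  finally show ?thesis .
qed

lemma abs_ln_diff_le:
  fixes x y c :: real
  assumes "0 < c" "c \<le> x" "c \<le> y"
  shows "\<bar>ln x - ln y\<bar> \<le> \<bar>x - y\<bar> / c"
proof -
  have one_sided: "ln x - ln y \<le> \<bar>x - y\<bar> / c" if "c \<le> x" "c \<le> y" for x y
  proof -
    have "ln x - ln y \<le> (x - y) / y" using that assms by (intro ln_diff_le) auto
    also have "\<dots> \<le> \<bar>x - y\<bar> / c" using that assms by (intro frac_le) auto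
    finally show ?thesis .
  qed
  from one_sided[of x y] one_sided[of y x] assms show ?thesis by (auto simp: abs_minus_commute[of y x])
qed

lemma norm_digit_phase [simp]: "cmod (digit_phase \<alpha> k r) = 1"
  by (simp add: digit_phase_def)

lemma digit_phase_diff_le:
  assumes "0 \<le> r" "0 \<le> s"
  shows "cmod (digit_phase \<alpha> k r - digit_phase \<alpha> k s) \<le> \<bar>\<alpha>\<bar> * \<bar>r - s\<bar>"
proof -
  have "cmod (digit_phase \<alpha> k r - digit_phase \<alpha> k s)
      \<le> \<bar>\<alpha>\<bar> * \<bar>ln (real k + 1 + r) - ln (real k + 1 + s)\<bar>"
    using cmod_cis_diff_le[of "\<alpha> * ln (real k + 1 + r)" "\<alpha> * ln (real k + 1 + s)"]
    by (simp add: digit_phase_def abs_mult flip: right_diff_distrib)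
  also have "\<dots> \<le> \<bar>\<alpha>\<bar> * (\<bar>(real k + 1 + r) - (real k + 1 + s)\<bar> / 1)"
    using assms by (intro mult_left_mono abs_ln_diff_le) auto
  finally show ?thesis by simp
qed

lemma abs_gauss_branch_diff_le:
  assumes "0 \<le> r" "0 \<le> s"
  shows "\<bar>gauss_branch k r - gauss_branch k s\<bar> \<le> \<bar>r - s\<bar> / (real k + 1)\<^sup>2"
proof -
  have "gauss_branch k r - gauss_branch k s = (s - r) / ((real k + 1 + r) * (real k + 1 + s))"
    using assms by (simp add: gauss_branch_def diff_frac_eq)
  also have "\<bar>\<dots>\<bar> = \<bar>r - s\<bar> / ((real k + 1 + r) * (real k + 1 + s))"
    using assms by (simp add: abs_mult abs_minus_commute)
  also have "\<dots> \<le> \<bar>r - s\<bar> / (real k + 1)\<^sup>2"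
    using assms unfolding power2_eq_square by (intro divide_left_mono mult_mono mult_pos_pos) auto
  finally show ?thesis .
qed

lemma norm_twisted_branch_le:
  assumes "\<And>r. r \<in> {0..1} \<Longrightarrow> cmod (f r) \<le> M" "r \<in> {0..1}"
  shows "cmod (twisted_branch \<alpha> f r k) \<le> M"
  using assms gauss_branch_mem[of r k] by (simp add: twisted_branch_def norm_mult)

lemma norm_twisted_branch_diff_le:
  assumes bound: "\<And>r. r \<in> {0..1} \<Longrightarrow> cmod (f r) \<le> M" and lip: "\<Lambda>-lipschitz_on {0..1} f"
    and r: "r \<in> {0..1}" and s: "s \<in> {0..1}" and c: "0 < c" "c \<le> (real k + 1)\<^sup>2"
  shows "cmod (twisted_branch \<alpha> f r k - twisted_branch \<alpha> f s k) \<le> (\<bar>\<alpha>\<bar> * M + \<Lambda> / c) * \<bar>r - s\<bar>"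
proof -
  define u where "u x = digit_phase \<alpha> k x" for x
  define v where "v x = f (gauss_branch k x)" for x
  have \<Lambda>: "0 \<le> \<Lambda>" using lip by (rule lipschitz_on_nonneg)
  have "cmod ((u r - u s) * v r) \<le> (\<bar>\<alpha>\<bar> * \<bar>r - s\<bar>) * M"
    unfolding norm_mult u_def v_def using r s
    by (intro mult_mono digit_phase_diff_le bound gauss_branch_mem) auto
  moreover have "cmod (u s * (v r - v s)) \<le> \<Lambda> * (\<bar>r - s\<bar> / c)"
  proof -
    have "cmod (v r - v s) \<le> \<Lambda> * \<bar>gauss_branch k r - gauss_branch k s\<bar>"
      using lipschitz_onD[OF lip gauss_branch_mem gauss_branch_mem, of r s k k] r s
      by (simp add: v_def dist_norm)
    also have "\<dots> \<le> \<Lambda> * (\<bar>r - s\<bar> / (real k + 1)\<^sup>2)"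
      using \<Lambda> r s by (intro mult_left_mono abs_gauss_branch_diff_le) auto
    also have "\<dots> \<le> \<Lambda> * (\<bar>r - s\<bar> / c)"
      using \<Lambda> c by (intro mult_left_mono divide_left_mono mult_pos_pos) auto
    finally show ?thesis by (simp add: norm_mult u_def)
  qed
  moreover have "twisted_branch \<alpha> f r k - twisted_branch \<alpha> f s k
      = (u r - u s) * v r + u s * (v r - v s)"
    by (simp add: twisted_branch_def u_def v_def algebra_simps)
  ultimately have "cmod (twisted_branch \<alpha> f r k - twisted_branch \<alpha> f s k)
      \<le> \<bar>\<alpha>\<bar> * \<bar>r - s\<bar> * M + \<Lambda> * (\<bar>r - s\<bar> / c)"
    by (simp only: norm_triangle_mono)
  then show ?thesis by (simp add: algebra_simps)
qed

text \<open>An inequality of Lasota--Yorke type: the Lipschitz constant of \<open>f\<close> enters with a factor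
  below 1, since the branches contract by \<open>1 / (k + 1)\<^sup>2\<close> and the first digit has weight at
  most 1/2.\<close>

lemma twisted_transfer_lipschitz:
  assumes bound: "\<And>r. r \<in> {0..1} \<Longrightarrow> cmod (f r) \<le> M" and lip: "\<Lambda>-lipschitz_on {0..1} f"
  shows "((2 + \<bar>\<alpha>\<bar>) * M + 5 / 8 * \<Lambda>)-lipschitz_on {0..1} (twisted_transfer \<alpha> f)"
proof (rule lipschitz_onI)
  have \<Lambda>: "0 \<le> \<Lambda>" using lip by (rule lipschitz_on_nonneg)
  have M: "0 \<le> M" by (rule order.trans[OF norm_ge_zero bound[of 0]]) simp
  then show "0 \<le> (2 + \<bar>\<alpha>\<bar>) * M + 5 / 8 * \<Lambda>" using \<Lambda> by simp
  fix r s :: real assume r: "r \<in> {0..1}" and s: "s \<in> {0..1}"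
  define b where "b = twisted_branch \<alpha> f"
  have b_bound: "cmod (b x k) \<le> M" if "x \<in> {0..1}" for x k
    unfolding b_def using bound that by (rule norm_twisted_branch_le)
  have b_diff: "cmod (b r k - b s k) \<le> (\<bar>\<alpha>\<bar> * M + \<Lambda> / c) * \<bar>r - s\<bar>"
    if "0 < c" "c \<le> (real k + 1)\<^sup>2" for k c
    unfolding b_def using bound lip r s that by (rule norm_twisted_branch_diff_le)
  have "digit_mean s (\<lambda>k. b r k - b s k) = digit_mean s (b r) - digit_mean s (b s)"
    using s b_bound[OF r] b_bound[OF s] by (intro digit_mean_diff) auto
  then have "twisted_transfer \<alpha> f r - twisted_transfer \<alpha> f s
      = (digit_mean r (b r) - digit_mean s (b r)) + digit_mean s (\<lambda>k. b r k - b s k)"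
    by (simp add: twisted_transfer_def b_def)
  also have "cmod \<dots> \<le> 2 * M * \<bar>r - s\<bar>
      + ((\<bar>\<alpha>\<bar> * M + \<Lambda> / 1) * \<bar>r - s\<bar> + (\<bar>\<alpha>\<bar> * M + \<Lambda> / 4) * \<bar>r - s\<bar>) / 2"
  proof (intro norm_triangle_mono norm_digit_mean_diff_le norm_digit_mean_le_midpoint)
    show "cmod (b r k - b s k) \<le> (\<bar>\<alpha>\<bar> * M + \<Lambda> / 4) * \<bar>r - s\<bar>" if "0 < k" for k
      using that power_mono[of 2 "real k + 1" 2] by (intro b_diff) auto
    show "cmod (b r 0 - b s 0) \<le> (\<bar>\<alpha>\<bar> * M + \<Lambda> / 1) * \<bar>r - s\<bar>"
      by (intro b_diff) auto
    show "(\<bar>\<alpha>\<bar> * M + \<Lambda> / 4) * \<bar>r - s\<bar> \<le> (\<bar>\<alpha>\<bar> * M + \<Lambda> / 1) * \<bar>r - s\<bar>"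
      using \<Lambda> by (intro mult_right_mono) auto
  qed (use r s b_bound in auto)
  also have "\<dots> = ((2 + \<bar>\<alpha>\<bar>) * M + 5 / 8 * \<Lambda>) * \<bar>r - s\<bar>"
    by (simp add: field_simps)
  finally show "dist (twisted_transfer \<alpha> f r) (twisted_transfer \<alpha> f s)
      \<le> ((2 + \<bar>\<alpha>\<bar>) * M + 5 / 8 * \<Lambda>) * dist r s"
    by (simp add: dist_norm)
qed

lemma cmod_cis_ln_add_le:
  assumes \<alpha>: "\<alpha> \<noteq> 0" and y: "0 < y" and c: "0 < c"
  defines "\<kappa> \<equiv> exp (pi / \<bar>\<alpha>\<bar>)"
  assumes bounds: "c \<le> \<kappa> * y" "c \<le> z"
  shows "cmod (cis (\<alpha> * ln y) + cis (\<alpha> * ln z)) \<le> \<bar>\<alpha>\<bar> * (\<bar>z - \<kappa> * y\<bar> / c)"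
proof -
  have "ln (\<kappa> * y) = ln \<kappa> + ln y" using y by (intro ln_mult_pos) (simp_all add: \<kappa>_def)
  moreover have "\<alpha> * ln \<kappa> = sgn \<alpha> * pi" using \<alpha> by (simp add: \<kappa>_def sgn_real_def abs_if)
  ultimately have "cis (\<alpha> * ln (\<kappa> * y)) = cis (\<alpha> * ln y) * cis (sgn \<alpha> * pi)"
    by (simp only: distrib_left cis_mult add.commute)
  also have "cis (sgn \<alpha> * pi) = - 1" using \<alpha> by (simp add: sgn_real_def complex_eq_iff)
  finally have "cmod (cis (\<alpha> * ln y) + cis (\<alpha> * ln z))
      = cmod (cis (\<alpha> * ln z) - cis (\<alpha> * ln (\<kappa> * y)))"
    by (simp add: add.commute)
  also have "\<dots> \<le> \<bar>\<alpha>\<bar> * \<bar>ln z - ln (\<kappa> * y)\<bar>"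
    using cmod_cis_diff_le[of "\<alpha> * ln z" "\<alpha> * ln (\<kappa> * y)"]
    by (simp add: abs_mult flip: right_diff_distrib)
  also have "\<dots> \<le> \<bar>\<alpha>\<bar> * (\<bar>z - \<kappa> * y\<bar> / c)"
    using bounds c by (intro mult_left_mono abs_ln_diff_le) auto
  finally show ?thesis .
qed

text \<open>Two large digits whose ratio is close to \<open>exp (pi / \<bar>\<alpha>\<bar>)\<close> are in opposite phase.\<close>

lemma opposite_digit_phases:
  fixes N :: nat
  assumes \<alpha>: "\<alpha> \<noteq> 0" and \<epsilon>: "0 < \<epsilon>"
  obtains i j where "N \<le> i" "i < j"
    "\<And>r. r \<in> {0..1} \<Longrightarrow> cmod (digit_phase \<alpha> i r + digit_phase \<alpha> j r) \<le> \<epsilon>"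
proof -
  define \<kappa> where "\<kappa> = exp (pi / \<bar>\<alpha>\<bar>)"
  have \<kappa>: "1 < \<kappa>" using \<alpha> by (simp add: \<kappa>_def)
  define i where "i = max N (nat \<lceil>\<bar>\<alpha>\<bar> * \<kappa> / \<epsilon>\<rceil>)"
  define j where "j = nat \<lceil>\<kappa> * (real i + 1)\<rceil> - 1"
  have i: "\<bar>\<alpha>\<bar> * \<kappa> / \<epsilon> \<le> real i + 1" by (auto simp: i_def max_def) linarith+
  have "real i + 1 < \<kappa> * (real i + 1)" using \<kappa> by simp
  moreover from this have "1 \<le> \<lceil>\<kappa> * (real i + 1)\<rceil>" by linarith
  then have "real j + 1 = of_int \<lceil>\<kappa> * (real i + 1)\<rceil>" unfolding j_def by linarith
  ultimately have j: "real i < real j"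
    "\<kappa> * (real i + 1) \<le> real j + 1" "real j + 1 < \<kappa> * (real i + 1) + 1"
    by linarith+
  have "cmod (digit_phase \<alpha> i r + digit_phase \<alpha> j r) \<le> \<epsilon>"
    if r: "r \<in> {0..1}" for r
  proof -
    let ?y = "real i + 1 + r" and ?z = "real j + 1 + r"
    have "real i + 1 \<le> \<kappa> * ?y" using \<kappa> r mult_mono[of 1 \<kappa> "real i + 1" ?y] by simp
    then have "cmod (digit_phase \<alpha> i r + digit_phase \<alpha> j r) \<le> \<bar>\<alpha>\<bar> * (\<bar>?z - \<kappa> * ?y\<bar> / (real i + 1))"
      unfolding digit_phase_def \<kappa>_def using j r by (intro cmod_cis_ln_add_le \<alpha>) auto
    also have "\<dots> \<le> \<bar>\<alpha>\<bar> * (\<kappa> / (real i + 1))"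
    proof (intro mult_left_mono divide_right_mono)
      have "0 \<le> (\<kappa> - 1) * r" "(\<kappa> - 1) * r \<le> \<kappa> - 1"
        using \<kappa> r by (simp_all add: mult_left_le)
      then show "\<bar>?z - \<kappa> * ?y\<bar> \<le> \<kappa>" using j by (simp add: algebra_simps abs_le_iff)
    qed auto
    also have "\<dots> \<le> \<epsilon>" using i \<epsilon> by (simp add: field_simps)
    finally show ?thesis .
  qed
  then show thesis using that[of i j] j(1) by (simp add: i_def)
qed

lemma lipschitz_class_bound: "f \<in> lipschitz_class L M \<Longrightarrow> r \<in> {0..1} \<Longrightarrow> cmod (f r) \<le> M"
  by (simp add: lipschitz_class_def)

lemma lipschitz_class_nonneg:
  assumes "f \<in> lipschitz_class L M"
  shows "0 \<le> M"
  by (rule order.trans[OF norm_ge_zero lipschitz_class_bound[OF assms, of 0]]) simp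

lemma lipschitz_class_gauss_branch_near_0:
  assumes f: "f \<in> lipschitz_class L M" and r: "0 \<le> r" and k: "4 * L \<le> real k"
  shows "cmod (f (gauss_branch k r) - f 0) \<le> M / 4"
proof -
  have "cmod (f (gauss_branch k r) - f 0) \<le> L * M * gauss_branch k r"
    using f gauss_branch_mem[OF r, of k]
    by (auto simp: lipschitz_class_def dist_norm dest: lipschitz_onD[of _ _ _ "gauss_branch k r" 0])
  also have "\<dots> = L * gauss_branch k r * M" by simp
  also have "\<dots> \<le> 1 / 4 * M"
  proof (rule mult_right_mono)
    show "L * gauss_branch k r \<le> 1 / 4" using r k by (simp add: gauss_branch_def field_simps)
  qed (rule lipschitz_class_nonneg[OF f])
  finally show ?thesis by simp
qed

lemma cmod_twisted_branch_pair_le: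
  assumes f: "f \<in> lipschitz_class L M" and r: "r \<in> {0..1}"
    and large: "4 * L \<le> real i" "4 * L \<le> real j"
    and phases: "cmod (digit_phase \<alpha> i r + digit_phase \<alpha> j r) \<le> 1 / 2"
  shows "cmod (twisted_branch \<alpha> f r i + twisted_branch \<alpha> f r j) \<le> M"
proof -
  define u where "u k = digit_phase \<alpha> k r" for k
  have "twisted_branch \<alpha> f r i + twisted_branch \<alpha> f r j = (u i + u j) * f 0
      + (u i * (f (gauss_branch i r) - f 0) + u j * (f (gauss_branch j r) - f 0))"
    by (simp add: twisted_branch_def u_def algebra_simps)
  also have "cmod \<dots> \<le> 1 / 2 * M + (M / 4 + M / 4)"
  proof (intro norm_triangle_mono)
    have "cmod (u k * (f (gauss_branch k r) - f 0)) \<le> M / 4" if "4 * L \<le> real k" for k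
      using lipschitz_class_gauss_branch_near_0[OF f _ that, of r] r by (simp add: norm_mult u_def)
    then show "cmod (u i * (f (gauss_branch i r) - f 0)) \<le> M / 4"
      "cmod (u j * (f (gauss_branch j r) - f 0)) \<le> M / 4"
      using large by blast+
    show "cmod ((u i + u j) * f 0) \<le> 1 / 2 * M"
      unfolding norm_mult u_def using phases lipschitz_class_bound[OF f, of 0]
      by (intro mult_mono) auto
  qed
  finally show ?thesis by simp
qed

lemma twisted_transfer_bound:
  assumes \<alpha>: "\<alpha> \<noteq> 0"
  obtains \<rho> where "\<rho> < 1"
    "\<And>M f r. f \<in> lipschitz_class L M \<Longrightarrow> r \<in> {0..1} \<Longrightarrow> cmod (twisted_transfer \<alpha> f r) \<le> \<rho> * M"
proof -
  obtain i j where ij: "nat \<lceil>4 * L\<rceil> \<le> i" "i < j" and phases: "\<And>r. r \<in> {0..1} \<Longrightarrow>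
      cmod (digit_phase \<alpha> i r + digit_phase \<alpha> j r) \<le> 1 / 2"
    using opposite_digit_phases[OF \<alpha>, of "1 / 2" "nat \<lceil>4 * L\<rceil>"] by auto
  have large: "4 * L \<le> real i" "4 * L \<le> real j" using ij by linarith+
  define m where "m = 1 / ((real j + 2) * (real j + 3))"
  have m: "0 < m" by (simp add: m_def)
  have "m \<le> 1 / ((real i + 2) * (real i + 3))"
    unfolding m_def using ij by (intro divide_left_mono mult_mono mult_pos_pos) auto
  then have weights: "m \<le> digit_weight i r" "m \<le> digit_weight j r" if "r \<in> {0..1}" for r
    using digit_weight_ge[OF that, of i] digit_weight_ge[OF that, of j] by (simp_all add: m_def)
  show thesis
  proof (rule that)
    show "1 - m < 1" using m by simp
    fix M f and r :: real assume f: "f \<in> lipschitz_class L M" and r: "r \<in> {0..1}"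
    have "cmod (twisted_transfer \<alpha> f r)
        \<le> (1 - 2 * m) * M + m * cmod (twisted_branch \<alpha> f r i + twisted_branch \<alpha> f r j)"
      unfolding twisted_transfer_def
      using r ij m weights[OF r] norm_twisted_branch_le[OF lipschitz_class_bound[OF f]]
      by (intro norm_digit_mean_le_pair) auto
    also have "\<dots> \<le> (1 - 2 * m) * M + m * M"
      using m cmod_twisted_branch_pair_le[OF f r large phases[OF r]]
      by (intro add_left_mono mult_left_mono) auto
    finally show "cmod (twisted_transfer \<alpha> f r) \<le> (1 - m) * M" by (simp add: algebra_simps)
  qed
qed

theorem twisted_transfer_contraction:
  assumes \<alpha>: "\<alpha> \<noteq> 0"
  obtains \<rho> L where "0 \<le> \<rho>" "\<rho> < 1" "0 \<le> L"
    "\<And>M f. f \<in> lipschitz_class L M \<Longrightarrow> twisted_transfer \<alpha> f \<in> lipschitz_class L (\<rho> * M)"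
proof -
  define L where "L = 8 * (2 + \<bar>\<alpha>\<bar>)"
  have L: "0 \<le> L" by (simp add: L_def)
  obtain \<rho>' where \<rho>': "\<rho>' < 1" and bound: "\<And>M f r. f \<in> lipschitz_class L M \<Longrightarrow> r \<in> {0..1} \<Longrightarrow>
      cmod (twisted_transfer \<alpha> f r) \<le> \<rho>' * M"
    using twisted_transfer_bound[OF \<alpha>] by metis
  define \<rho> where "\<rho> = max (3 / 4) \<rho>'"
  show thesis
  proof (rule that)
    show "0 \<le> \<rho>" "\<rho> < 1" "0 \<le> L" using \<rho>' L by (simp_all add: \<rho>_def max_def)
    fix M f assume f: "f \<in> lipschitz_class L M"
    then have M: "0 \<le> M" by (rule lipschitz_class_nonneg)
    have "((2 + \<bar>\<alpha>\<bar>) * M + 5 / 8 * (L * M))-lipschitz_on {0..1} (twisted_transfer \<alpha> f)"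
      using f by (intro twisted_transfer_lipschitz) (auto simp: lipschitz_class_def)
    moreover have "(2 + \<bar>\<alpha>\<bar>) * M + 5 / 8 * (L * M) = L * (3 / 4 * M)"
      by (simp add: L_def algebra_simps)
    moreover have "L * (3 / 4 * M) \<le> L * (\<rho> * M)"
      using L M by (intro mult_left_mono mult_right_mono) (auto simp: \<rho>_def)
    ultimately have "(L * (\<rho> * M))-lipschitz_on {0..1} (twisted_transfer \<alpha> f)"
      by (auto intro: lipschitz_on_mono)
    moreover have "cmod (twisted_transfer \<alpha> f r) \<le> \<rho> * M" if "r \<in> {0..1}" for r
      using bound[OF f that] mult_right_mono[of \<rho>' \<rho> M] M by (simp add: \<rho>_def)
    ultimately show "twisted_transfer \<alpha> f \<in> lipschitz_class L (\<rho> * M)"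
      by (simp add: lipschitz_class_def)
  qed
qed

section \<open>Correlations of the denominators\<close>

lemma gauss_map_irrational:
  assumes "x \<in> {0<..<1}" "x \<notin> \<rat>"
  shows "gauss_map x \<in> {0<..<1}" "gauss_map x \<notin> \<rat>"
proof -
  have "gauss_map x + of_int \<lfloor>1 / x\<rfloor> = 1 / x" by (simp add: gauss_map_def)
  moreover have "1 / x \<notin> \<rat>"
    using assms Rats_divide[OF Rats_1, of "1 / x"] by auto
  ultimately show irrational: "gauss_map x \<notin> \<rat>" by (metis Rats_add Rats_of_int)
  have "gauss_map x = frac (1 / x)" by (simp add: gauss_map_def frac_def)
  then have "0 \<le> gauss_map x" "gauss_map x < 1" by (simp_all only: frac_ge_0 frac_lt_1)
  moreover have "gauss_map x \<noteq> 0" using irrational by (metis Rats_0)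
  ultimately show "gauss_map x \<in> {0<..<1}" by simp
qed

lemma gauss_map_gauss_branch:
  assumes "s \<in> {0<..<1}"
  shows "\<lfloor>1 / gauss_branch k s\<rfloor> = int k + 1" "gauss_map (gauss_branch k s) = s"
proof -
  show "\<lfloor>1 / gauss_branch k s\<rfloor> = int k + 1"
    using assms by (simp add: gauss_branch_def floor_eq_iff)
  then show "gauss_map (gauss_branch k s) = s" by (simp add: gauss_map_def gauss_branch_def)
qed

lemma gauss_branch_gauss_map:
  assumes "x \<in> {0<..<1}"
  shows "gauss_branch (nat \<lfloor>1 / x\<rfloor> - 1) (gauss_map x) = x"
proof -
  define k where "k = nat \<lfloor>1 / x\<rfloor> - 1"
  have "1 \<le> \<lfloor>1 / x\<rfloor>" using assms by simp
  then have "real k + 1 = of_int \<lfloor>1 / x\<rfloor>" unfolding k_def by linarith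
  then have "gauss_branch k (gauss_map x) = x" by (simp add: gauss_branch_def gauss_map_def)
  then show ?thesis by (simp add: k_def)
qed

lemma inj_on_gauss_branch: "inj_on (gauss_branch k) {0<..<1}"
  by (metis gauss_map_gauss_branch(2) inj_onI)

lemma open_gauss_branch_image: "open (gauss_branch k ` {0<..<1})"
proof (rule injective_into_1d_imp_open_map_UNIV[OF _ _ inj_on_gauss_branch])
  show "continuous_on {0<..<1} (gauss_branch k)"
    unfolding gauss_branch_def by (intro continuous_intros) auto
qed auto

lemma gauss_branch_image_subset: "gauss_branch k ` {0<..<1} \<subseteq> {0<..<1}"
  by (auto simp: gauss_branch_def field_simps)

lemma disjoint_gauss_branch_images:
  assumes "i \<noteq> j"
  shows "gauss_branch i ` {0<..<1} \<inter> gauss_branch j ` {0<..<1} = {}"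
proof -
  have "\<lfloor>1 / x\<rfloor> = int k + 1" if "x \<in> gauss_branch k ` {0<..<1}" for x k
    using that gauss_map_gauss_branch(1) by auto
  then show ?thesis using assms by (metis add_right_cancel disjoint_iff of_nat_eq_iff)
qed

lemma negligible_unit_interval_minus_gauss_branches:
  "negligible ({0<..<1} - (\<Union>k. gauss_branch k ` {0<..<1}))"
proof (rule negligible_subset)
  show "negligible (\<rat> :: real set)"
    by (simp add: negligible_iff_null_sets null_sets_completionI countable_imp_null_set_lborel
        countable_rat)
  show "{0<..<1} - (\<Union>k. gauss_branch k ` {0<..<1}) \<subseteq> \<rat>"
  proof
    fix x assume x: "x \<in> {0<..<1} - (\<Union>k. gauss_branch k ` {0<..<1})"
    show "x \<in> \<rat>"
    proof (rule ccontr)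
      assume "x \<notin> \<rat>"
      then have "gauss_map x \<in> {0<..<1}" using x gauss_map_irrational by blast
      then have "x \<in> gauss_branch (nat \<lfloor>1 / x\<rfloor> - 1) ` {0<..<1}"
        using x gauss_branch_gauss_map[of x] by (metis DiffD1 image_eqI)
      with x show False by blast
    qed
  qed
qed

lemma integral_gauss_branch_image:
  fixes f :: "real \<Rightarrow> 'a::euclidean_space"
  assumes "f absolutely_integrable_on gauss_branch k ` {0<..<1}"
  shows "integral (gauss_branch k ` {0<..<1}) f
    = integral {0<..<1} (\<lambda>s. (gauss_branch k s)\<^sup>2 *\<^sub>R f (gauss_branch k s))"
proof -
  let ?g = "\<lambda>s. \<bar>- (gauss_branch k s)\<^sup>2\<bar> *\<^sub>R f (gauss_branch k s)"
  have "?g absolutely_integrable_on {0<..<1} \<and> integral {0<..<1} ?g = b \<longleftrightarrow>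
      f absolutely_integrable_on gauss_branch k ` {0<..<1} \<and>
      integral (gauss_branch k ` {0<..<1}) f = b" for b
  proof (rule has_absolute_integral_change_of_variables_real)
    show "(gauss_branch k has_field_derivative - (gauss_branch k s)\<^sup>2) (at s within {0<..<1})"
      if "s \<in> {0<..<1}" for s
      unfolding gauss_branch_def using that
      by (auto intro!: derivative_eq_intros simp: power2_eq_square)
  qed (simp_all add: inj_on_gauss_branch)
  then show ?thesis using assms by auto
qed

lemma integral_unit_interval_gauss_branches:
  fixes f :: "real \<Rightarrow> 'a::euclidean_space"
  assumes f: "f absolutely_integrable_on {0<..<1}"
  shows "integral {0<..<1} f
    = (\<Sum>k. integral {0<..<1} (\<lambda>s. (gauss_branch k s)\<^sup>2 *\<^sub>R f (gauss_branch k s)))"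
proof -
  define A where "A k = gauss_branch k ` {0<..<1}" for k
  have subset: "A k \<subseteq> {0<..<1}" for k
    unfolding A_def by (rule gauss_branch_image_subset)
  have sets: "A k \<in> sets lebesgue" for k
    unfolding A_def using open_gauss_branch_image[of k] by simp
  have fA: "f absolutely_integrable_on A k" for k
    using set_integrable_subset[OF f sets subset] .
  have fU: "f absolutely_integrable_on (\<Union>k. A k)"
    using sets subset by (intro set_integrable_subset[OF f]) auto
  have "integral {0<..<1} f = integral (\<Union>k. A k) f"
  proof (rule integral_spike_set)
    show "negligible {x \<in> {0<..<1} - (\<Union>k. A k). f x \<noteq> 0}"
      by (rule negligible_subset[OF negligible_unit_interval_minus_gauss_branches])
        (auto simp: A_def)
    show "negligible {x \<in> (\<Union>k. A k) - {0<..<1}. f x \<noteq> 0}"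
      by (rule negligible_subset[OF negligible_empty]) (use subset in blast)
  qed
  also have "\<dots> = (LINT t:(\<Union>k. A k)|lebesgue. f t)"
    using set_lebesgue_integral_eq_integral(2)[OF fU] by simp
  also have "\<dots> = (\<Sum>k. LINT t:A k|lebesgue. f t)"
    unfolding A_def using sets fU disjoint_gauss_branch_images
    by (intro lebesgue_integral_countable_add) (simp_all add: A_def)
  also have "\<dots> = (\<Sum>k. integral {0<..<1} (\<lambda>s. (gauss_branch k s)\<^sup>2 *\<^sub>R f (gauss_branch k s)))"
    using set_lebesgue_integral_eq_integral(2)[OF fA]
      integral_gauss_branch_image[OF fA[unfolded A_def]]
    by (simp only: A_def)
  finally show ?thesis .
qed

definition cylinder_density :: "real \<Rightarrow> real \<Rightarrow> real" where
  "cylinder_density r t = (1 + r) / (1 + r * t)\<^sup>2"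

definition cylinder_mean :: "real \<Rightarrow> (real \<Rightarrow> 'a::euclidean_space) \<Rightarrow> 'a" where
  "cylinder_mean r F = integral {0<..<1} (\<lambda>t. cylinder_density r t *\<^sub>R F t)"

lemma cylinder_density_bounds:
  assumes "r \<in> {0..1}" "t \<in> {0..1}"
  shows "0 \<le> cylinder_density r t" "cylinder_density r t \<le> 2"
proof -
  have "1 \<le> (1 + r * t)\<^sup>2" using assms by (intro one_le_power) simp
  then have "(1 + r) / (1 + r * t)\<^sup>2 \<le> 2 / 1" using assms by (intro frac_le) auto
  then show "cylinder_density r t \<le> 2" by (simp add: cylinder_density_def)
  show "0 \<le> cylinder_density r t" using assms by (simp add: cylinder_density_def)
qed

lemma cylinder_integrable:
  fixes F :: "real \<Rightarrow> 'a::euclidean_space"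
  assumes [measurable]: "F \<in> borel_measurable borel"
    and bound: "\<And>t. norm (F t) \<le> B" and r: "r \<in> {0..1}"
  shows "(\<lambda>t. cylinder_density r t *\<^sub>R F t) absolutely_integrable_on {0<..<1}"
proof (rule measurable_bounded_by_integrable_imp_absolutely_integrable)
  have "(\<lambda>t. cylinder_density r t *\<^sub>R F t) \<in> borel_measurable borel"
    unfolding cylinder_density_def by measurable
  then have "(\<lambda>t. cylinder_density r t *\<^sub>R F t) \<in> borel_measurable lebesgue"
    by (simp add: measurable_completion)
  then show "(\<lambda>t. cylinder_density r t *\<^sub>R F t) \<in> borel_measurable (lebesgue_on {0<..<1})"
    by (rule measurable_restrict_space1)
  show "(\<lambda>t. 2 * B) integrable_on {0<..<1::real}"
    by (subst integrable_on_open_interval_real) (rule integrable_const_ivl)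
  show "norm (cylinder_density r t *\<^sub>R F t) \<le> 2 * B" if "t \<in> {0<..<1}" for t
    using that cylinder_density_bounds[OF r, of t] bound[of t] by (auto intro!: mult_mono)
qed auto

lemma cylinder_density_gauss_branch:
  assumes r: "r \<in> {0..1}" and s: "s \<in> {0<..<1}"
  shows "(gauss_branch k s)\<^sup>2 * cylinder_density r (gauss_branch k s)
    = digit_weight k r * cylinder_density (gauss_branch k r) s"
proof -
  define a where "a = real k + 1"
  have a: "1 \<le> a" by (simp add: a_def)
  have nz: "a + s \<noteq> 0" "a + r \<noteq> 0" "a + r + s \<noteq> 0" "a + r + 1 \<noteq> 0" using a r s by auto
  have branch: "gauss_branch k x = 1 / (a + x)" for x by (simp add: gauss_branch_def a_def)
  have "1 + r * (1 / (a + s)) = (a + r + s) / (a + s)" using nz by (simp add: field_simps)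
  then have "(gauss_branch k s)\<^sup>2 * cylinder_density r (gauss_branch k s) = (1 + r) / (a + r + s)\<^sup>2"
    using nz by (simp add: branch cylinder_density_def power_divide)
  also have "\<dots> = (1 + r) / ((a + r) * (a + r + 1)) * ((a + r + 1) * (a + r) / (a + r + s)\<^sup>2)"
    using nz by simp
  also have "(a + r + 1) * (a + r) / (a + r + s)\<^sup>2 = cylinder_density (gauss_branch k r) s"
  proof -
    have "1 + 1 / (a + r) * s = (a + r + s) / (a + r)" "1 + 1 / (a + r) = (a + r + 1) / (a + r)"
      using nz by (simp_all add: field_simps)
    then show ?thesis
      using nz by (simp add: branch cylinder_density_def power_divide power2_eq_square)
  qed
  also have "(1 + r) / ((a + r) * (a + r + 1)) = digit_weight k r"
    by (simp add: digit_weight_def a_def add_ac)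
  finally show ?thesis .
qed

lemma cylinder_mean_markov:
  fixes F :: "real \<Rightarrow> 'a::euclidean_space"
  assumes F: "F \<in> borel_measurable borel" "\<And>t. norm (F t) \<le> B" and r: "r \<in> {0..1}"
  shows "cylinder_mean r F =
    digit_mean r (\<lambda>k. cylinder_mean (gauss_branch k r) (\<lambda>s. F (gauss_branch k s)))"
proof -
  have "integral {0<..<1}
        (\<lambda>s. (gauss_branch k s)\<^sup>2 *\<^sub>R cylinder_density r (gauss_branch k s) *\<^sub>R F (gauss_branch k s))
      = digit_weight k r *\<^sub>R cylinder_mean (gauss_branch k r) (\<lambda>s. F (gauss_branch k s))"
    (is "integral _ ?f = _") for k
  proof -
    have "integral {0<..<1} ?f = integral {0<..<1}
        (\<lambda>s. digit_weight k r *\<^sub>R cylinder_density (gauss_branch k r) s *\<^sub>R F (gauss_branch k s))"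
      by (intro integral_cong) (simp only: scaleR_scaleR cylinder_density_gauss_branch[OF r])
    then show ?thesis
      by (simp only: cylinder_mean_def Henstock_Kurzweil_Integration.integral_cmul)
  qed
  then show ?thesis
    using integral_unit_interval_gauss_branches[OF cylinder_integrable[OF F r]]
    by (simp add: cylinder_mean_def digit_mean_def)
qed

lemma cylinder_mean_const:
  assumes "r \<in> {0..1}"
  shows "cylinder_mean r (\<lambda>_. c) = c"
proof -
  have pos: "0 < 1 + r * t" if "t \<in> {0..1}" for t using that assms by (simp add: add_pos_nonneg)
  have "(cylinder_density r has_integral
      (1 + r) * 1 / (1 + r * 1) - (1 + r) * 0 / (1 + r * 0)) {0..1}"
  proof (rule fundamental_theorem_of_calculus)
    fix t :: real assume t: "t \<in> {0..1}"
    show "((\<lambda>t. (1 + r) * t / (1 + r * t)) has_vector_derivative cylinder_density r t)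
        (at t within {0..1})"
      unfolding has_real_derivative_iff_has_vector_derivative[symmetric] cylinder_density_def
      using pos[OF t]
      by (auto intro!: derivative_eq_intros simp: power2_eq_square) (simp add: field_simps)
  qed simp
  then have "(cylinder_density r has_integral 1) {0<..<1}"
    using assms by (simp add: has_integral_Icc_iff_Ioo)
  from has_integral_scaleR_left[OF this, of c] show ?thesis
    by (simp add: cylinder_mean_def integral_unique)
qed

lemma cylinder_mean_cong:
  "(\<And>t. t \<in> {0<..<1} \<Longrightarrow> F t = G t) \<Longrightarrow> cylinder_mean r F = cylinder_mean r G"
  unfolding cylinder_mean_def by (intro integral_cong) auto

lemma cylinder_mean_mult_left:
  fixes F :: "real \<Rightarrow> complex"
  shows "cylinder_mean r (\<lambda>t. c * F t) = c * cylinder_mean r F"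
  by (simp add: cylinder_mean_def flip: mult_scaleR_right)

text \<open>The digits of \<open>t\<close> continue a past with \<open>q\<^sub>m\<^sub>-\<^sub>1 / q\<^sub>m = r\<close>; they contribute
  \<open>log_denom n r t = ln (q\<^sub>m\<^sub>+\<^sub>n / q\<^sub>m)\<close>.\<close>

fun log_denom :: "nat \<Rightarrow> real \<Rightarrow> real \<Rightarrow> real" where
  "log_denom 0 r t = 0"
| "log_denom (Suc n) r t =
     ln (of_int \<lfloor>1 / t\<rfloor> + r) + log_denom n (1 / (of_int \<lfloor>1 / t\<rfloor> + r)) (gauss_map t)"

lemma log_denom_gauss_branch:
  assumes "s \<in> {0<..<1}"
  shows "log_denom (Suc n) r (gauss_branch k s)
    = ln (real k + 1 + r) + log_denom n (gauss_branch k r) s"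
  by (simp add: gauss_map_gauss_branch[OF assms] gauss_branch_def[of k r])

lemma measurable_log_denom [measurable]: "log_denom n r \<in> borel_measurable borel"
proof (induction n arbitrary: r)
  case 0
  have "log_denom 0 r = (\<lambda>_. 0)" by (rule ext) simp
  then show ?case by simp
next
  case (Suc n)
  have gauss [measurable]: "gauss_map \<in> borel_measurable borel"
    unfolding gauss_map_def[abs_def] by measurable
  have "(\<lambda>t. ln (of_int a + r) + log_denom n (1 / (of_int a + r)) (gauss_map t))
      \<in> borel_measurable borel" for a :: int
    using measurable_compose[OF gauss Suc.IH] by measurable
  then have "(\<lambda>t. ln (of_int \<lfloor>1 / t\<rfloor> + r) + log_denom n (1 / (of_int \<lfloor>1 / t\<rfloor> + r)) (gauss_map t))
      \<in> borel_measurable borel"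
    by (rule measurable_compose_countable) measurable
  also have "(\<lambda>t. ln (of_int \<lfloor>1 / t\<rfloor> + r) + log_denom n (1 / (of_int \<lfloor>1 / t\<rfloor> + r)) (gauss_map t))
      = log_denom (Suc n) r"
    by (rule ext) simp
  finally show ?case .
qed

lemma borel_measurable_cis:
  assumes "\<theta> \<in> borel_measurable M"
  shows "(\<lambda>t. cis (\<theta> t)) \<in> borel_measurable M"
  by (rule measurable_compose[OF assms]) (intro borel_measurable_continuous_onI continuous_intros)

definition phase_mean :: "real \<Rightarrow> nat \<Rightarrow> nat \<Rightarrow> real \<Rightarrow> complex" where
  "phase_mean \<alpha> m n r = cylinder_mean r (\<lambda>t. cis (\<alpha> * (log_denom n r t - log_denom m r t)))"

lemma phase_mean_markov:
  assumes "r \<in> {0..1}"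
  shows "phase_mean \<alpha> m n r = digit_mean r (\<lambda>k. cylinder_mean (gauss_branch k r)
    (\<lambda>s. cis (\<alpha> * (log_denom n r (gauss_branch k s) - log_denom m r (gauss_branch k s)))))"
  unfolding phase_mean_def
  by (rule cylinder_mean_markov[OF _ _ assms, where B = 1]) (auto intro!: borel_measurable_cis)

lemma phase_mean_Suc_Suc:
  assumes "r \<in> {0..1}"
  shows "phase_mean \<alpha> (Suc m) (Suc n) r = digit_mean r (\<lambda>k. phase_mean \<alpha> m n (gauss_branch k r))"
proof -
  have "cylinder_mean (gauss_branch k r) (\<lambda>s. cis (\<alpha> *
        (log_denom (Suc n) r (gauss_branch k s) - log_denom (Suc m) r (gauss_branch k s))))
      = phase_mean \<alpha> m n (gauss_branch k r)" for k
    unfolding phase_mean_def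
    by (rule cylinder_mean_cong) (simp only: log_denom_gauss_branch add_diff_cancel_left)
  then show ?thesis by (simp only: phase_mean_markov[OF assms])
qed

lemma phase_mean_0_Suc:
  assumes "r \<in> {0..1}"
  shows "phase_mean \<alpha> 0 (Suc n) r = twisted_transfer \<alpha> (phase_mean \<alpha> 0 n) r"
proof -
  have "cylinder_mean (gauss_branch k r) (\<lambda>s. cis (\<alpha> *
        (log_denom (Suc n) r (gauss_branch k s) - log_denom 0 r (gauss_branch k s))))
      = twisted_branch \<alpha> (phase_mean \<alpha> 0 n) r k" for k
    unfolding twisted_branch_def digit_phase_def phase_mean_def cylinder_mean_mult_left[symmetric]
    by (rule cylinder_mean_cong)
      (simp only: log_denom_gauss_branch log_denom.simps(1) diff_0_right distrib_left cis_mult)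
  then show ?thesis by (simp add: phase_mean_markov[OF assms] twisted_transfer_def)
qed

lemma phase_mean_decay:
  assumes "\<alpha> \<noteq> 0"
  obtains \<rho> where "0 \<le> \<rho>" "\<rho> < 1"
    "\<And>m n r. r \<in> {0..1} \<Longrightarrow> cmod (phase_mean \<alpha> m (m + n) r) \<le> \<rho> ^ n"
proof -
  obtain \<rho> L where \<rho>: "0 \<le> \<rho>" "\<rho> < 1" and L: "0 \<le> L" and contraction:
    "\<And>M f. f \<in> lipschitz_class L M \<Longrightarrow> twisted_transfer \<alpha> f \<in> lipschitz_class L (\<rho> * M)"
    using twisted_transfer_contraction[OF assms] by metis
  have initial: "phase_mean \<alpha> 0 n \<in> lipschitz_class L (\<rho> ^ n)" for n
  proof (induction n)
    case 0
    show ?case using L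
      by (auto simp: lipschitz_class_def phase_mean_def cylinder_mean_const intro!: lipschitz_onI)
  next
    case (Suc n)
    from contraction[OF this] show ?case
      by (auto simp: lipschitz_class_def phase_mean_0_Suc elim: lipschitz_on_transform)
  qed
  have "cmod (phase_mean \<alpha> m (m + n) r) \<le> \<rho> ^ n" if "r \<in> {0..1}" for m n r
    using that
  proof (induction m arbitrary: r)
    case 0
    then show ?case using initial[of n] by (simp add: lipschitz_class_def)
  next
    case (Suc m)
    have "cmod (phase_mean \<alpha> m (m + n) (gauss_branch k r)) \<le> \<rho> ^ n" for k
      using Suc.prems by (intro Suc.IH gauss_branch_mem) simp
    then show ?case using Suc.prems by (simp add: phase_mean_Suc_Suc norm_digit_mean_le)
  qed
  with \<rho> show thesis by (rule that)
qed

section \<open>Denominators of convergents\<close>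

definition cf_digits :: "nat \<Rightarrow> real \<Rightarrow> nat list" where
  "cf_digits n x = map (\<lambda>i. cf_digit i x) [1..<n + 1]"

fun cf_fraction :: "nat list \<Rightarrow> int \<times> int" where
  "cf_fraction [] = (0, 1)"
| "cf_fraction (a # as) =
     (snd (cf_fraction as), int a * snd (cf_fraction as) + fst (cf_fraction as))"

lemma cf_fraction_nonneg: "0 \<le> fst (cf_fraction as) \<and> 0 \<le> snd (cf_fraction as)"
  by (induction as) auto

lemma quotient_of_cf_value:
  assumes "\<forall>a\<in>set as. 0 < a"
  shows "quotient_of (cf_value as) = cf_fraction as"
  using assms
proof (induction as)
  case (Cons a as)
  obtain p q where pq: "cf_fraction as = (p, q)" by fastforce
  then have IH: "quotient_of (cf_value as) = (p, q)" using Cons by simp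
  have q: "0 < q" using quotient_of_denom_pos[OF IH] .
  have denom: "0 < int a * q + p"
    using Cons.prems q cf_fraction_nonneg[of as] by (simp add: pq add_pos_nonneg)
  have "coprime q (int a * q + p)"
    using quotient_of_coprime[OF IH]
    by (metis coprime_commute coprime_iff_gcd_eq_1 gcd_add_mult add.commute)
  moreover have "cf_value (a # as) = Fract q (int a * q + p)"
  proof -
    have "of_nat a + cf_value as = of_int (int a * q + p) / of_int q"
      using q by (simp add: quotient_of_div[OF IH] field_simps)
    then show ?thesis by (simp add: Fract_of_int_quotient)
  qed
  ultimately show ?case using denom by (simp add: pq quotient_of_Fract)
qed simp

lemma cf_digits_0: "cf_digits 0 x = []"
  by (simp add: cf_digits_def)

lemma cf_digits_Suc: "cf_digits (Suc n) x = nat \<lfloor>1 / x\<rfloor> # cf_digits n (gauss_map x)"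
proof -
  have "[1..<Suc n + 1] = 1 # map Suc [1..<n + 1]"
    by (simp add: upt_conv_Cons map_Suc_upt del: upt_Suc)
  moreover have "cf_digit (Suc i) x = cf_digit i (gauss_map x)" if "1 \<le> i" for i
    using that by (cases i) (simp_all add: cf_digit_def funpow_swap1)
  then have "map (\<lambda>i. cf_digit i x) (map Suc [1..<n + 1]) = cf_digits n (gauss_map x)"
    by (simp add: cf_digits_def del: upt_Suc)
  ultimately show ?thesis by (simp only: cf_digits_def list.map) (simp add: cf_digit_def)
qed

lemma cf_digits_pos:
  assumes "x \<in> {0<..<1}" "x \<notin> \<rat>"
  shows "\<forall>a\<in>set (cf_digits n x). 0 < a"
  using assms
proof (induction n arbitrary: x)
  case (Suc n)
  have "0 < nat \<lfloor>1 / x\<rfloor>" using Suc.prems(1) by simp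
  then show ?case
    using Suc.IH[OF gauss_map_irrational[OF Suc.prems]] by (simp add: cf_digits_Suc)
qed (simp add: cf_digits_0)

lemma exp_log_denom:
  assumes "x \<in> {0<..<1}" "x \<notin> \<rat>" "0 \<le> r"
  shows "exp (log_denom n r x)
    = of_int (snd (cf_fraction (cf_digits n x))) + r * of_int (fst (cf_fraction (cf_digits n x)))"
  using assms
proof (induction n arbitrary: x r)
  case 0
  then show ?case by (simp add: cf_digits_0)
next
  case (Suc n)
  define a where "a = real_of_int \<lfloor>1 / x\<rfloor>"
  have a: "0 < a + r" "0 \<le> \<lfloor>1 / x\<rfloor>" using Suc.prems by (simp_all add: a_def add_pos_nonneg)
  define p where "p = real_of_int (fst (cf_fraction (cf_digits n (gauss_map x))))"
  define q where "q = real_of_int (snd (cf_fraction (cf_digits n (gauss_map x))))"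
  have "exp (log_denom (Suc n) r x) = (a + r) * exp (log_denom n (1 / (a + r)) (gauss_map x))"
    using a by (simp add: exp_add a_def)
  also have "exp (log_denom n (1 / (a + r)) (gauss_map x)) = q + 1 / (a + r) * p"
    unfolding p_def q_def using a Suc.prems by (intro Suc.IH gauss_map_irrational) simp_all
  also have "(a + r) * (q + 1 / (a + r) * p) = (a * q + p) + r * q"
    using a by (simp add: field_simps)
  finally show ?case using a by (simp add: cf_digits_Suc p_def q_def a_def)
qed

lemma ln_cf_denom:
  assumes "x \<in> {0<..<1}" "x \<notin> \<rat>"
  shows "ln (real_of_int (cf_denom n x)) = log_denom n 0 x"
proof -
  have "cf_denom n x = snd (cf_fraction (cf_digits n x))"
    using quotient_of_cf_value[OF cf_digits_pos[OF assms]] by (simp add: cf_denom_def cf_digits_def)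
  then have "real_of_int (cf_denom n x) = exp (log_denom n 0 x)"
    by (simp add: exp_log_denom[OF assms])
  then show ?thesis by simp
qed

lemma cf_denom_pos: "0 < cf_denom n x"
  by (simp add: cf_denom_def quotient_of_denom_pos')

section \<open>Uniform distribution of the logarithms\<close>

lemma cylinder_mean_0_eq_lebesgue_integral:
  fixes F :: "real \<Rightarrow> 'a::euclidean_space"
  assumes F: "F \<in> borel_measurable borel" "\<And>t. norm (F t) \<le> B"
  shows "cylinder_mean 0 F = (\<integral>t. F t \<partial>restrict_space lborel {0<..<1})"
proof -
  have "set_integrable lebesgue {0<..<1} F"
    using cylinder_integrable[OF F, of 0] by (simp add: cylinder_density_def)
  then have "set_integrable lborel {0<..<1} F"
    using F(1) unfolding set_integrable_def by (subst (asm) integrable_completion) auto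
  then show ?thesis
    by (simp add: cylinder_mean_def cylinder_density_def integral_restrict_space
        set_borel_integral_eq_integral(2) flip: set_lebesgue_integral_def)
qed

lemma AE_exponential_means_tendsto_0:
  assumes "\<alpha> \<noteq> 0"
  shows "AE x in lborel. x \<in> {0<..<1} \<longrightarrow> cesaro_mean (\<lambda>n. cis (\<alpha> * log_denom n 0 x)) \<longlonglongrightarrow> 0"
proof -
  define M where "M = restrict_space lborel {0<..<1::real}"
  interpret finite_measure M
    by (rule finite_measureI) (simp add: M_def emeasure_restrict_space space_restrict_space)
  obtain \<rho> where \<rho>: "0 \<le> \<rho>" "\<rho> < 1"
    and decay: "\<And>m n r. r \<in> {0..1} \<Longrightarrow> cmod (phase_mean \<alpha> m (m + n) r) \<le> \<rho> ^ n"
    using phase_mean_decay[OF assms] by metis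
  have phase_measurable: "(\<lambda>x. cis (\<alpha> * log_denom n 0 x)) \<in> borel_measurable M" for n
    unfolding M_def by (intro measurable_restrict_space1 borel_measurable_cis) measurable
  have correlation: "(\<integral>x. cis (\<alpha> * log_denom m 0 x) \<bullet> cis (\<alpha> * log_denom (m + n) 0 x) \<partial>M) \<le> \<rho> ^ n"
    for m n
  proof -
    let ?F = "\<lambda>x. cis (\<alpha> * (log_denom (m + n) 0 x - log_denom m 0 x))"
    have F: "?F \<in> borel_measurable borel" by (intro borel_measurable_cis) measurable
    then have "integrable M ?F"
      by (intro integrable_const_bound[where B = 1]) (auto simp: M_def measurable_restrict_space1)
    then have "(\<integral>x. Re (?F x) \<partial>M) = Re (\<integral>x. ?F x \<partial>M)" by (rule integral_Re)
    also have "(\<integral>x. ?F x \<partial>M) = phase_mean \<alpha> m (m + n) 0"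
      unfolding phase_mean_def M_def
      using F by (intro cylinder_mean_0_eq_lebesgue_integral[symmetric, where B = 1]) auto
    also have "Re \<dots> \<le> \<rho> ^ n"
      using decay[of 0 m n] by (intro order.trans[OF complex_Re_le_cmod]) simp
    finally show ?thesis
      by (simp add: inner_complex_def right_diff_distrib cos_diff mult_ac add_ac)
  qed
  have "AE x in M. cesaro_mean (\<lambda>n. cis (\<alpha> * log_denom n 0 x)) \<longlonglongrightarrow> 0"
    by (rule AE_cesaro_mean_tendsto_0_of_correlations[where B = 1 and c = "\<lambda>n. \<rho> ^ n"])
      (use phase_measurable correlation \<rho> in \<open>simp_all add: summable_geometric\<close>)
  then show ?thesis unfolding M_def by (subst (asm) AE_restrict_space_iff) auto
qed

theorem AE_uniformly_distributed_ln_cf_denom: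
  assumes c: "c \<noteq> 0"
  shows "AE x in lborel. x \<in> {0<..<1} \<longrightarrow>
    uniformly_distributed_mod1 (\<lambda>n. c * ln (real_of_int (cf_denom n x)))"
proof -
  have "AE x in lborel. \<forall>h::nat. 0 < h \<longrightarrow> x \<in> {0<..<1} \<longrightarrow>
      cesaro_mean (\<lambda>n. cis (2 * pi * real h * c * log_denom n 0 x)) \<longlonglongrightarrow> 0"
    unfolding AE_all_countable using c by (intro allI AE_impI AE_exponential_means_tendsto_0) simp
  moreover have "AE x in lborel. x \<notin> (\<rat> :: real set)"
    by (intro AE_not_in countable_imp_null_set_lborel countable_rat)
  ultimately show ?thesis
  proof eventually_elim
    case (elim x)
    show ?case
    proof
      assume x: "x \<in> {0<..<1}"
      have "weyl_sequence (\<lambda>n. c * log_denom n 0 x)"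
      proof (rule weyl_sequence.intro)
        fix h :: nat assume "0 < h"
        with elim(1) x show "cesaro_mean (\<lambda>n. cis (2 * pi * real h * (c * log_denom n 0 x))) \<longlonglongrightarrow> 0"
          by (simp add: mult.assoc)
      qed
      then show "uniformly_distributed_mod1 (\<lambda>n. c * ln (real_of_int (cf_denom n x)))"
        unfolding ln_cf_denom[OF x elim(2)] by (rule weyl_sequence.weyl_criterion)
    qed
  qed
qed

theorem theorem1p1:
  shows "AE x in lborel. x \<in> {0<..<1} \<longrightarrow> benford (\<lambda>n. real_of_int (cf_denom n x))"
proof -
  have "AE x in lborel. x \<in> {0<..<1} \<longrightarrow>
      uniformly_distributed_mod1 (\<lambda>n. 1 / ln 10 * ln (real_of_int (cf_denom n x)))"
    by (rule AE_uniformly_distributed_ln_cf_denom) simp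
  moreover have "1 / ln 10 * ln (real_of_int (cf_denom n x)) = log 10 \<bar>real_of_int (cf_denom n x)\<bar>"
    for n x
    using cf_denom_pos[of n x] by (simp add: log_def)
  moreover have "real_of_int (cf_denom n x) \<noteq> 0" for n x
    using cf_denom_pos[of n x] by simp
  ultimately show ?thesis
    by (simp add: benford_iff_uniformly_distributed_log)
qed

end
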